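(* If $Ef$ is proper on $\mathcal{N}^\infty$, then its recession function is $$(Ef)^\infty(x)=E\big[I_{h^\infty}(x)+k_0^\infty(x_0)+k_T^\infty(x_{T+})\big]\qquad(x\in\mathcal{N}^\infty).$$
   Context: $T>0$, $d\ge1$. $X$: left-continuous $x:\mathbb{R}\to\mathbb{R}^d$ of bounded variation constant on $(-\infty,0]$ and $(T,\infty)$; $x_{T+}$ value on $(T,\infty)$. $(\Omega,\mathcal{F},(\mathcal{F}_t)_{t\ge0},P)$: filtered probability space with the usual hypotheses; optional projection ${}^ov$ as usual. $\mathcal{N}^\infty$: adapted processes with paths in $X$ a.s. and essentially bounded total variation. $\mu$: random positive Radon measure on $[0,T]$, a.s. atomless with full support, optional ($E\int v\,d\mu=E\int{}^ov\,d\mu$ for bounded measurable $v$); $\eta(A)=E\int1_Ad\mu$; $\mathbb{L}^p=L^p(\Omega\times[0,T],\mathcal{F}\otimes\mathcal{B}([0,T]),\eta)$. $h$: predictable convex normal integrand on $\mathbb{R}^d$ with $h_t(x)\ge x\cdot v_t-\alpha_t$ for some $v\in\mathbb{L}^1$ and nonnegative $\alpha\in\mathbb{L}^1$; for a normal integrand $g$, $I_g(x,\omega)=\int g_t(x_t,\omega)d\mu_t(\omega)$ (integral $+\infty$ unless positive part integrable). $k_0,k_T$: convex normal integrands on $\mathbb{R}^d$, $\mathcal{F}_0$- resp. $\mathcal{F}_T$-measurable, with $Ek_0,Ek_T$ proper on $L^\infty(\mathbb{R}^d)$ and $Ek_0^*,Ek_T^*$ proper on $L^1(\mathbb{R}^d)$.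 $f(x,\omega)=I_h(x,\omega)+k_0(x_0,\omega)+k_T(x_{T+},\omega)$, $Ef(x)=E f(x)$. Recession function of a closed proper convex $g$: $g^\infty(u)=\sup_{\alpha>0}(g(\bar u+\alpha u)-g(\bar u))/\alpha$ for any $\bar u\in\operatorname{dom}g$; $h^\infty$, $k_0^\infty$, $k_T^\infty$ are defined pointwise in $(\omega,t)$ resp. $\omega$. *)

theory Defs
  imports "HOL-Probability.Probability"
begin

definition ext_integral :: "'a measure \<Rightarrow> ('a \<Rightarrow> ereal) \<Rightarrow> ereal" where
  "ext_integral N g =
     (let p = (\<integral>\<^sup>+ s. e2ennreal (max 0 (g s)) \<partial>N);
          n = (\<integral>\<^sup>+ s. e2ennreal (max 0 (- g s)) \<partial>N)
      in if p = \<infinity> then \<infinity> else enn2ereal p - enn2ereal n)"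

definition epi :: "('v \<Rightarrow> ereal) \<Rightarrow> ('v \<times> real) set" where
  "epi g = {(x, a). g x \<le> ereal a}"

definition normal_integrand :: "'s measure \<Rightarrow> ('s \<Rightarrow> 'v::topological_space \<Rightarrow> ereal) \<Rightarrow> bool" where
  "normal_integrand S g \<longleftrightarrow>
     (\<forall>s\<in>space S. closed (epi (g s))) \<and>
     (\<forall>G. open G \<longrightarrow> {s\<in>space S. epi (g s) \<inter> G \<noteq> {}} \<in> sets S)"

definition convex_normal_integrand :: "'s measure \<Rightarrow> ('s \<Rightarrow> 'v::real_normed_vector \<Rightarrow> ereal) \<Rightarrow> bool" where
  "convex_normal_integrand S g \<longleftrightarrow> normal_integrand S g \<and> (\<forall>s\<in>space S. convex (epi (g s)))"

definition conjugate :: "('v::real_inner \<Rightarrow> ereal) \<Rightarrow> 'v \<Rightarrow> ereal" where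
  "conjugate g y = (SUP x. ereal (x \<bullet> y) - g x)"

definition recession_at :: "('v::real_vector \<Rightarrow> ereal) \<Rightarrow> 'v \<Rightarrow> 'v \<Rightarrow> ereal" where
  "recession_at g ub u = (SUP a\<in>{0<..}. (g (ub + a *\<^sub>R u) - g ub) / ereal a)"

definition recession :: "('v::real_vector \<Rightarrow> ereal) \<Rightarrow> 'v \<Rightarrow> ereal" where
  "recession g = recession_at g (SOME ub. g ub \<noteq> \<infinity> \<and> g ub \<noteq> -\<infinity>)"

definition usual_filtration :: "'w measure \<Rightarrow> (real \<Rightarrow> 'w measure) \<Rightarrow> bool" where
  "usual_filtration M F \<longleftrightarrow>
     (\<forall>t\<ge>0. space (F t) = space M \<and> sets (F t) \<subseteq> sets M) \<and>
     (\<forall>s t. 0 \<le> s \<longrightarrow> s \<le> t \<longrightarrow> sets (F s) \<subseteq> sets (F t)) \<and>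
     (\<forall>A N. A \<in> null_sets M \<longrightarrow> N \<subseteq> A \<longrightarrow> N \<in> sets M) \<and>
     (\<forall>A N. A \<in> null_sets M \<longrightarrow> N \<subseteq> A \<longrightarrow> N \<in> sets (F 0)) \<and>
     (\<forall>t\<ge>0. sets (F t) = (\<Inter>s\<in>{t<..}. sets (F s)))"

definition adapted :: "'w measure \<Rightarrow> (real \<Rightarrow> 'w measure) \<Rightarrow> ('w \<Rightarrow> real \<Rightarrow> 'b::topological_space) \<Rightarrow> bool" where
  "adapted M F X \<longleftrightarrow> (\<forall>t\<ge>0. (\<lambda>\<omega>. X \<omega> t) \<in> borel_measurable (F t))"

definition stopping_time_e :: "'w measure \<Rightarrow> (real \<Rightarrow> 'w measure) \<Rightarrow> ('w \<Rightarrow> ereal) \<Rightarrow> bool" where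
  "stopping_time_e M F \<tau> \<longleftrightarrow> (\<forall>\<omega>\<in>space M. 0 \<le> \<tau> \<omega>) \<and>
     (\<forall>t\<ge>0. {\<omega>\<in>space M. \<tau> \<omega> \<le> ereal t} \<in> sets (F t))"

definition F_infty :: "'w measure \<Rightarrow> (real \<Rightarrow> 'w measure) \<Rightarrow> 'w set set" where
  "F_infty M F = sigma_sets (space M) (\<Union>t\<in>{0..}. sets (F t))"

definition F_tau :: "'w measure \<Rightarrow> (real \<Rightarrow> 'w measure) \<Rightarrow> ('w \<Rightarrow> ereal) \<Rightarrow> 'w measure" where
  "F_tau M F \<tau> = sigma (space M)
     {A \<in> F_infty M F. \<forall>t\<ge>0. {\<omega>\<in>A. \<tau> \<omega> \<le> ereal t} \<in> sets (F t)}"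

definition optional_sigma :: "'w measure \<Rightarrow> (real \<Rightarrow> 'w measure) \<Rightarrow> ('w \<times> real) measure" where
  "optional_sigma M F = sigma (space M \<times> {0..})
     {{p\<in>space M \<times> {0..}. X (fst p) (snd p) \<in> B} | (X :: 'w \<Rightarrow> real \<Rightarrow> real) B.
        adapted M F X \<and>
        (\<forall>\<omega>\<in>space M. \<forall>t\<ge>0. continuous (at_right t) (X \<omega>) \<and>
            (t > 0 \<longrightarrow> (\<exists>l. (X \<omega> \<longlongrightarrow> l) (at_left t)))) \<and>
        B \<in> sets borel}"

definition predictable_sigma :: "'w measure \<Rightarrow> (real \<Rightarrow> 'w measure) \<Rightarrow> real \<Rightarrow> ('w \<times> real) measure" where
  "predictable_sigma M F T = sigma (space M \<times> {0..T})
     {{p\<in>space M \<times> {0..T}. X (fst p) (snd p) \<in> B} | (X :: 'w \<Rightarrow> real \<Rightarrow> real) B.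
        adapted M F X \<and>
        (\<forall>\<omega>\<in>space M. \<forall>t>0. continuous (at_left t) (X \<omega>)) \<and>
        B \<in> sets borel}"

definition optional_projection :: "'w measure \<Rightarrow> (real \<Rightarrow> 'w measure) \<Rightarrow>
    ('w \<Rightarrow> real \<Rightarrow> real) \<Rightarrow> ('w \<Rightarrow> real \<Rightarrow> real) \<Rightarrow> bool" where
  "optional_projection M F v w \<longleftrightarrow>
     (\<lambda>p. w (fst p) (snd p)) \<in> borel_measurable (optional_sigma M F) \<and>
     (\<forall>\<tau>. stopping_time_e M F \<tau> \<longrightarrow>
        (AE \<omega> in M. \<tau> \<omega> < \<infinity> \<longrightarrow>
           w \<omega> (real_of_ereal (\<tau> \<omega>)) =
           real_cond_exp M (F_tau M F \<tau>)
             (\<lambda>\<omega>'. if \<tau> \<omega>' < \<infinity> then v \<omega>' (real_of_ereal (\<tau> \<omega>')) else 0) \<omega>))"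

definition random_measure_ok ::
  "'w measure \<Rightarrow> (real \<Rightarrow> 'w measure) \<Rightarrow> real \<Rightarrow> ('w \<Rightarrow> real measure) \<Rightarrow> bool" where
  "random_measure_ok M F T \<mu> \<longleftrightarrow>
     \<comment> \<open>positive Radon measure on [0,T] for every \<omega>\<close>
     (\<forall>\<omega>\<in>space M. sets (\<mu> \<omega>) = sets (restrict_space borel {0..T}) \<and>
                   emeasure (\<mu> \<omega>) {0..T} < \<infinity>) \<and>
     \<comment> \<open>random: measurable dependence on \<omega>\<close>
     (\<forall>A\<in>sets borel. (\<lambda>\<omega>. emeasure (\<mu> \<omega>) (A \<inter> {0..T})) \<in> borel_measurable M) \<and>
     \<comment> \<open>almost surely atomless\<close>
     (AE \<omega> in M. \<forall>t. emeasure (\<mu> \<omega>) ({t} \<inter> {0..T}) = 0) \<and>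
     \<comment> \<open>almost surely full support\<close>
     (AE \<omega> in M. \<forall>U. open U \<longrightarrow> U \<inter> {0..T} \<noteq> {} \<longrightarrow> 0 < emeasure (\<mu> \<omega>) (U \<inter> {0..T})) \<and>
     \<comment> \<open>optional\<close>
     (\<forall>v w. (\<lambda>p. v (fst p) (snd p)) \<in> borel_measurable (M \<Otimes>\<^sub>M borel) \<longrightarrow>
            (\<exists>C. \<forall>\<omega> t. \<bar>v \<omega> t\<bar> \<le> C) \<longrightarrow>
            optional_projection M F v w \<longrightarrow>
            (\<integral>\<omega>. (\<integral>t. v \<omega> t \<partial>\<mu> \<omega>) \<partial>M) = (\<integral>\<omega>. (\<integral>t. w \<omega> t \<partial>\<mu> \<omega>) \<partial>M))"

text \<open>Membership in L^1(\<eta>), \<eta>(A) = E \<integral> 1_A d\<mu>.\<close>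
definition in_L1_eta :: "'w measure \<Rightarrow> ('w \<Rightarrow> real measure) \<Rightarrow> ('w \<Rightarrow> real \<Rightarrow> 'b::euclidean_space) \<Rightarrow> bool" where
  "in_L1_eta M \<mu> v \<longleftrightarrow>
     (\<lambda>p. v (fst p) (snd p)) \<in> borel_measurable (M \<Otimes>\<^sub>M borel) \<and>
     (\<integral>\<^sup>+\<omega>. (\<integral>\<^sup>+t. ennreal (norm (v \<omega> t)) \<partial>\<mu> \<omega>) \<partial>M) < \<infinity>"

definition total_variation :: "(real \<Rightarrow> 'b::real_normed_vector) \<Rightarrow> ereal" where
  "total_variation x =
     (SUP p\<in>{(n, t). mono (t :: nat \<Rightarrow> real)}.
        ereal (\<Sum>i<fst p. norm (x (snd p (Suc i)) - x (snd p i))))"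

definition path_space :: "real \<Rightarrow> (real \<Rightarrow> 'b::real_normed_vector) set" where
  "path_space T = {x. (\<forall>t. continuous (at_left t) x) \<and> total_variation x < \<infinity> \<and>
       (\<forall>t\<le>0. x t = x 0) \<and> (\<forall>t>T. x t = x (T + 1))}"

text \<open>x_{T+}: the value of x on (T,\<infinity>).\<close>
definition endval :: "real \<Rightarrow> (real \<Rightarrow> 'b) \<Rightarrow> 'b" where
  "endval T x = x (T + 1)"

definition N_infty :: "'w measure \<Rightarrow> (real \<Rightarrow> 'w measure) \<Rightarrow> real \<Rightarrow> ('w \<Rightarrow> real \<Rightarrow> 'b::euclidean_space) set" where
  "N_infty M F T = {x. adapted M F x \<and> (AE \<omega> in M. x \<omega> \<in> path_space T) \<and>
      (\<exists>C::real. AE \<omega> in M. total_variation (x \<omega>) \<le> ereal C)}"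

definition I_int :: "('w \<Rightarrow> real measure) \<Rightarrow> ('w \<Rightarrow> real \<Rightarrow> 'b \<Rightarrow> ereal) \<Rightarrow> ('w \<Rightarrow> real \<Rightarrow> 'b) \<Rightarrow> 'w \<Rightarrow> ereal" where
  "I_int \<mu> g x \<omega> = ext_integral (\<mu> \<omega>) (\<lambda>t. g \<omega> t (x \<omega> t))"

definition f_int :: "('w \<Rightarrow> real measure) \<Rightarrow> real \<Rightarrow> ('w \<Rightarrow> real \<Rightarrow> 'b \<Rightarrow> ereal) \<Rightarrow>
    ('w \<Rightarrow> 'b \<Rightarrow> ereal) \<Rightarrow> ('w \<Rightarrow> 'b \<Rightarrow> ereal) \<Rightarrow> ('w \<Rightarrow> real \<Rightarrow> 'b) \<Rightarrow> 'w \<Rightarrow> ereal" where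
  "f_int \<mu> T h k0 kT x \<omega> = I_int \<mu> h x \<omega> + k0 \<omega> (x \<omega> 0) + kT \<omega> (endval T (x \<omega>))"

definition Ef :: "'w measure \<Rightarrow> ('w \<Rightarrow> real measure) \<Rightarrow> real \<Rightarrow> ('w \<Rightarrow> real \<Rightarrow> 'b \<Rightarrow> ereal) \<Rightarrow>
    ('w \<Rightarrow> 'b \<Rightarrow> ereal) \<Rightarrow> ('w \<Rightarrow> 'b \<Rightarrow> ereal) \<Rightarrow> ('w \<Rightarrow> real \<Rightarrow> 'b) \<Rightarrow> ereal" where
  "Ef M \<mu> T h k0 kT x = ext_integral M (f_int \<mu> T h k0 kT x)"

definition L_infty :: "'w measure \<Rightarrow> ('w \<Rightarrow> 'b::euclidean_space) set" where
  "L_infty M = {x. x \<in> borel_measurable M \<and> (\<exists>C. AE \<omega> in M. norm (x \<omega>) \<le> C)}"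

definition L_one :: "'w measure \<Rightarrow> ('w \<Rightarrow> 'b::euclidean_space) set" where
  "L_one M = {x. integrable M x}"

definition proper_on :: "'a set \<Rightarrow> ('a \<Rightarrow> ereal) \<Rightarrow> bool" where
  "proper_on D G \<longleftrightarrow> (\<forall>x\<in>D. G x \<noteq> -\<infinity>) \<and> (\<exists>x\<in>D. G x \<noteq> \<infinity>)"

end

theory Submission
  imports Defs
begin

text \<open>
  For fixed \<open>xb\<close> and \<open>x\<close> the difference quotients of a closed convex function along
  \<open>xb + a x\<close> increase with \<open>a\<close> to the recession function, whatever the base point. So the claim is
  monotone convergence, used twice: in \<open>t\<close> against \<open>\<mu> \<omega>\<close> and then in \<open>\<omega>\<close> against \<open>M\<close>. No integrable
  minorant of the quotients has to be exhibited: if all integrals along the ray are finite, the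
  first quotient is one; if some integral along the ray is \<open>\<infinity>\<close>, both sides are \<open>\<infinity>\<close>, as the
  integral at \<open>xb\<close> is finite. All that is needed is that no integral along the ray is
  \<open>-\<infinity>\<close>, which for \<open>h\<close> is the lower bound by \<open>v\<close> and \<open>\<alpha>\<close> and for \<open>Ef\<close> is properness.
  In particular it is harmless that \<open>N_infty\<close> does not bound the initial values \<open>x \<omega> 0\<close>.
\<close>

section \<open>Monotone difference quotients and integration\<close>

lemma ext_integral_cong_AE:
  assumes "AE s in N. f s = g s"
  shows "ext_integral N f = ext_integral N g"
proof -
  have "(\<integral>\<^sup>+ s. e2ennreal (max 0 (f s)) \<partial>N) = (\<integral>\<^sup>+ s. e2ennreal (max 0 (g s)) \<partial>N)"
    using assms by (intro nn_integral_cong_AE) auto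
  moreover have "(\<integral>\<^sup>+ s. e2ennreal (max 0 (- f s)) \<partial>N) = (\<integral>\<^sup>+ s. e2ennreal (max 0 (- g s)) \<partial>N)"
    using assms by (intro nn_integral_cong_AE) auto
  ultimately show ?thesis
    by (simp add: ext_integral_def)
qed

text \<open>Subtracting an element of [0, \<infinity>] from a finite number never yields
  \<infinity>, so finiteness from above depends on the positive part alone. Upper estimates below
  are therefore made for positive parts only.\<close>

lemma ext_integral_eq_PInf_iff:
  "ext_integral N f = \<infinity> \<longleftrightarrow> (\<integral>\<^sup>+ s. e2ennreal (max 0 (f s)) \<partial>N) = \<infinity>"
proof -
  have "enn2ereal p - enn2ereal n \<noteq> \<infinity>" if "p \<noteq> \<infinity>" for p n
    using that by (cases p; cases n) auto
  then show ?thesis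
    by (simp add: ext_integral_def Let_def)
qed

lemma e2ennreal_max_ereal: "e2ennreal (max 0 (ereal r)) = ennreal r"
  by (cases "0 \<le> r") (auto simp: max_def ennreal_neg)

lemma ext_integral_ereal:
  assumes "integrable N g"
  shows "ext_integral N (\<lambda>s. ereal (g s)) = ereal (\<integral>s. g s \<partial>N)"
proof -
  have "(\<integral>\<^sup>+ s. ennreal (g s) \<partial>N) \<noteq> \<infinity>" "(\<integral>\<^sup>+ s. ennreal (- g s) \<partial>N) \<noteq> \<infinity>"
    using assms by (auto simp: real_integrable_def)
  then obtain p n where "(\<integral>\<^sup>+ s. ennreal (g s) \<partial>N) = ennreal p" "0 \<le> p"
    "(\<integral>\<^sup>+ s. ennreal (- g s) \<partial>N) = ennreal n" "0 \<le> n"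
    by (metis ennreal_cases infinity_ennreal_def)
  then show ?thesis
    by (simp add: ext_integral_def e2ennreal_max_ereal real_lebesgue_integral_def[OF assms])
qed

text \<open>Both parts have finite integrals, so \<open>f\<close> is real almost everywhere and its
  real version is integrable. This gives access to the linearity of the Bochner integral.\<close>

lemma ext_integral_finiteE:
  assumes [measurable]: "f \<in> borel_measurable N"
    and fin: "ext_integral N f \<noteq> \<infinity>" "ext_integral N f \<noteq> -\<infinity>"
  obtains g where "integrable N g" "AE s in N. f s = ereal (g s)"
    "ext_integral N f = ereal (\<integral>s. g s \<partial>N)"
proof -
  define p n where "p = (\<integral>\<^sup>+ s. e2ennreal (max 0 (f s)) \<partial>N)"
    and "n = (\<integral>\<^sup>+ s. e2ennreal (max 0 (- f s)) \<partial>N)"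
  have p: "p \<noteq> \<infinity>"
    using fin(1) by (auto simp: ext_integral_def p_def)
  \<comment> \<open>As \<open>p\<close> is finite, \<open>n\<close> = \<infinity> would make the
    extended integral -\<infinity>.\<close>
  then have n: "n \<noteq> \<infinity>"
    using fin(2) by (cases p) (auto simp: ext_integral_def p_def[symmetric] n_def[symmetric])
  have "AE s in N. e2ennreal (max 0 (f s)) \<noteq> \<infinity>" "AE s in N. e2ennreal (max 0 (- f s)) \<noteq> \<infinity>"
    by (rule nn_integral_PInf_AE; use p n in \<open>simp add: p_def n_def\<close>)+
  then have eq: "AE s in N. f s = ereal (real_of_ereal (f s))"
  proof eventually_elim
    case (elim s)
    then show ?case by (cases "f s") auto
  qed
  have "(\<integral>\<^sup>+ s. ennreal (real_of_ereal (f s)) \<partial>N) = p"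
    unfolding p_def
  proof (rule nn_integral_cong_AE, use eq in eventually_elim)
    case (elim s)
    then show ?case by (metis e2ennreal_max_ereal)
  qed
  moreover have "(\<integral>\<^sup>+ s. ennreal (- real_of_ereal (f s)) \<partial>N) = n"
    unfolding n_def
  proof (rule nn_integral_cong_AE, use eq in eventually_elim)
    case (elim s)
    then show ?case by (metis e2ennreal_max_ereal uminus_ereal.simps(1))
  qed
  ultimately have int: "integrable N (\<lambda>s. real_of_ereal (f s))"
    using p n by (auto simp: real_integrable_def)
  show thesis
    using int eq ext_integral_cong_AE[OF eq] ext_integral_ereal[OF int] by (intro that) auto
qed

text \<open>Additivity also when \<phi> has an infinite integral: \<phi> is at most the positive
  part of the sum plus the negative part of \<open>g\<close>, and the latter has a finite integral,
  so the positive part of the sum must carry the infinity. If the integral of \<phi> is finite,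
  everything is real almost everywhere.\<close>

lemma ext_integral_add_nonneg:
  assumes g: "integrable N g" and [measurable]: "\<phi> \<in> borel_measurable N"
  shows "ext_integral N (\<lambda>s. ereal (g s) + enn2ereal (\<phi> s)) =
    ereal (\<integral>s. g s \<partial>N) + enn2ereal (\<integral>\<^sup>+ s. \<phi> s \<partial>N)"
proof (cases "(\<integral>\<^sup>+ s. \<phi> s \<partial>N) = \<infinity>")
  case True
  have [measurable]: "g \<in> borel_measurable N" using g by auto
  let ?p = "\<lambda>s. e2ennreal (max 0 (ereal (g s) + enn2ereal (\<phi> s)))"
  have "\<phi> s \<le> ?p s + ennreal (- g s)" for s
  proof (cases "\<phi> s")
    case (real r)
    have "ennreal r \<le> ennreal (max 0 (g s + r) + max 0 (- g s))"
      by (intro ennreal_leI) auto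
    also have "\<dots> = ennreal (max 0 (g s + r)) + ennreal (max 0 (- g s))"
      by (intro ennreal_plus) auto
    finally show ?thesis
      using real by (simp add: e2ennreal_max_ereal ennreal_max_0)
  qed simp
  then have "(\<integral>\<^sup>+ s. \<phi> s \<partial>N) \<le> (\<integral>\<^sup>+ s. ?p s + ennreal (- g s) \<partial>N)"
    by (intro nn_integral_mono)
  also have "\<dots> = (\<integral>\<^sup>+ s. ?p s \<partial>N) + (\<integral>\<^sup>+ s. ennreal (- g s) \<partial>N)"
    by (intro nn_integral_add) auto
  finally have "(\<integral>\<^sup>+ s. ?p s \<partial>N) = \<infinity>"
    using True g by (auto simp: real_integrable_def top_unique)
  then show ?thesis
    using True by (simp add: ext_integral_def)
next
  case False
  then have fin: "AE s in N. \<phi> s \<noteq> \<infinity>"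
    by (intro nn_integral_PInf_AE) auto
  then have eq: "AE s in N. \<phi> s = ennreal (enn2real (\<phi> s))"
    by eventually_elim (auto simp: less_top)
  then have nn: "(\<integral>\<^sup>+ s. \<phi> s \<partial>N) = (\<integral>\<^sup>+ s. ennreal (enn2real (\<phi> s)) \<partial>N)"
    by (rule nn_integral_cong_AE)
  have int: "integrable N (\<lambda>s. enn2real (\<phi> s))"
    using False nn by (auto simp: real_integrable_def ennreal_neg)
  have "AE s in N. ereal (g s) + enn2ereal (\<phi> s) = ereal (g s + enn2real (\<phi> s))"
    using fin
  proof eventually_elim
    case (elim s)
    then show ?case by (cases "\<phi> s") auto
  qed
  then have "ext_integral N (\<lambda>s. ereal (g s) + enn2ereal (\<phi> s)) =
      ext_integral N (\<lambda>s. ereal (g s + enn2real (\<phi> s)))"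
    by (rule ext_integral_cong_AE)
  also have "\<dots> = ereal (\<integral>s. g s + enn2real (\<phi> s) \<partial>N)"
    by (intro ext_integral_ereal Bochner_Integration.integrable_add g int)
  also have "\<dots> = ereal (\<integral>s. g s \<partial>N) + ereal (\<integral>s. enn2real (\<phi> s) \<partial>N)"
    using g int by simp
  also have "ereal (\<integral>s. enn2real (\<phi> s) \<partial>N) = enn2ereal (\<integral>\<^sup>+ s. \<phi> s \<partial>N)"
    unfolding nn by (subst nn_integral_eq_integral[OF int]) (auto simp: enn2ereal_ennreal)
  finally show ?thesis .
qed

text \<open>The positive integers are cofinal in the positive reals. A countable supremum is what
  measurability and monotone convergence can handle; \<open>Suc\<close> keeps the step length
  positive.\<close>

lemma SUP_pos_eq_SUP_nat:
  fixes q :: "real \<Rightarrow> ereal"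
  assumes mono: "\<And>a b. 0 < a \<Longrightarrow> a \<le> b \<Longrightarrow> q a \<le> q b"
  shows "(SUP a\<in>{0<..}. q a) = (SUP n. q (real (Suc n)))"
proof (rule antisym)
  show "(SUP a\<in>{0<..}. q a) \<le> (SUP n. q (real (Suc n)))"
  proof (rule SUP_least)
    fix a :: real assume "a \<in> {0<..}"
    moreover obtain n where "a \<le> real n" using real_arch_simple by blast
    ultimately have "q a \<le> q (real (Suc n))" by (intro mono) auto
    then show "q a \<le> (SUP n. q (real (Suc n)))" by (rule SUP_upper2[rotated]) simp
  qed
qed (auto intro!: SUP_least SUP_upper)

text \<open>The argument is a function of the step length with its base value at 0. One form thus
  serves values along a ray, integrals along a ray and sums of these.\<close>

abbreviation diff_quot :: "(real \<Rightarrow> ereal) \<Rightarrow> real \<Rightarrow> ereal" where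
  "diff_quot \<phi> a \<equiv> (\<phi> a - \<phi> 0) / ereal a"

text \<open>The index set must be nonempty because the empty supremum is 0 in \<open>ennreal\<close>
  but -\<infinity> in \<open>ereal\<close>.\<close>

lemma enn2ereal_SUP:
  assumes "I \<noteq> {}"
  shows "enn2ereal (SUP i\<in>I. f i) = (SUP i\<in>I. enn2ereal (f i))"
proof -
  have "0 \<le> (SUP i\<in>I. enn2ereal (f i))"
    using assms by (auto intro: SUP_upper2)
  then show ?thesis
    by (simp add: Sup_ennreal.rep_eq image_image sup_absorb2)
qed

text \<open>Wherever the integral along the ray is finite, the quotient of the integrals is the
  integral of the quotients, and monotone convergence applies. Monotonicity of the new quotients is
  a conclusion too, since the integral over time becomes one of the terms integrated over the
  probability space, where monotone quotients are assumed again.\<close>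

lemma ext_integral_diff_quot:
  fixes \<Phi> :: "real \<Rightarrow> 's \<Rightarrow> ereal"
  assumes meas: "\<And>a. a \<ge> 0 \<Longrightarrow> \<Phi> a \<in> borel_measurable N"
    and low: "\<And>a. 0 < a \<Longrightarrow> ext_integral N (\<Phi> a) \<noteq> -\<infinity>"
    and fin: "ext_integral N (\<Phi> 0) \<noteq> \<infinity>" "ext_integral N (\<Phi> 0) \<noteq> -\<infinity>"
    and mono: "AE s in N. \<forall>a b. 0 < a \<longrightarrow> a \<le> b \<longrightarrow> diff_quot (\<lambda>a. \<Phi> a s) a \<le> diff_quot (\<lambda>a. \<Phi> a s) b"
  shows ext_integral_diff_quot_mono: "0 < a \<Longrightarrow> a \<le> b \<Longrightarrow>
      diff_quot (\<lambda>a. ext_integral N (\<Phi> a)) a \<le> diff_quot (\<lambda>a. ext_integral N (\<Phi> a)) b"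
    and ext_integral_SUP_diff_quot: "(SUP a\<in>{0<..}. diff_quot (\<lambda>a. ext_integral N (\<Phi> a)) a) =
      ext_integral N (\<lambda>s. SUP a\<in>{0<..}. diff_quot (\<lambda>a. \<Phi> a s) a)"
proof -
  obtain g0 where g0: "integrable N g0" "AE s in N. \<Phi> 0 s = ereal (g0 s)"
      "ext_integral N (\<Phi> 0) = ereal (\<integral>s. g0 s \<partial>N)"
    using ext_integral_finiteE[OF meas fin] by auto
  have [measurable]: "g0 \<in> borel_measurable N" using g0(1) by auto
  \<comment> \<open>If the quotient at \<open>a\<close> is at most \<open>S\<close>, then \<Phi> at
    \<open>a\<close> is at most \<open>g0 + a * S\<close>, so its positive part is at most that of
    \<open>g0\<close> plus \<open>a\<close> times that of \<open>S\<close>. This is used with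
    \<open>S\<close> the quotient at a larger step, and in contraposition with \<open>S\<close> the
    supremum of the quotients.\<close>
  have fin_pos: "ext_integral N (\<Phi> a) \<noteq> \<infinity>"
    if a: "0 < a" and S[measurable]: "S \<in> borel_measurable N"
      and le: "AE s in N. diff_quot (\<lambda>a. \<Phi> a s) a \<le> S s"
      and S_fin: "ext_integral N S \<noteq> \<infinity>" for a S
  proof -
    have "AE s in N. e2ennreal (max 0 (\<Phi> a s)) \<le> ennreal (g0 s) + ennreal a * e2ennreal (max 0 (S s))"
      using le g0(2)
    proof eventually_elim
      case (elim s)
      show ?case
      proof (cases "S s")
        case (real r)
        with elim a have "\<Phi> a s \<le> ereal (g0 s + a * r)"
          by (cases "\<Phi> a s") (auto simp: field_simps split: if_splits)
        then have "e2ennreal (max 0 (\<Phi> a s)) \<le> ennreal (g0 s + a * r)"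
          unfolding e2ennreal_max_ereal[symmetric] by (intro e2ennreal_mono max.mono) auto
        also have "\<dots> \<le> ennreal (max 0 (g0 s) + a * max 0 r)"
          using a by (intro ennreal_leI add_mono mult_left_mono) auto
        also have "\<dots> = ennreal (g0 s) + ennreal a * ennreal r"
          using a by (simp add: ennreal_plus ennreal_mult ennreal_max_0)
        finally show ?thesis using real by (simp add: e2ennreal_max_ereal)
      next
        case PInf
        then show ?thesis using a by (simp add: ennreal_mult_top)
      next
        case MInf
        with elim a have "\<Phi> a s = -\<infinity>"
          by (cases "\<Phi> a s") (auto split: if_splits)
        then show ?thesis by simp
      qed
    qed
    then have "(\<integral>\<^sup>+ s. e2ennreal (max 0 (\<Phi> a s)) \<partial>N)
        \<le> (\<integral>\<^sup>+ s. ennreal (g0 s) + ennreal a * e2ennreal (max 0 (S s)) \<partial>N)"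
      by (rule nn_integral_mono_AE)
    also have "\<dots> = (\<integral>\<^sup>+ s. ennreal (g0 s) \<partial>N) + ennreal a * (\<integral>\<^sup>+ s. e2ennreal (max 0 (S s)) \<partial>N)"
      by (subst nn_integral_add) (auto simp: nn_integral_cmult)
    also have "\<dots> < \<infinity>"
    proof -
      have "(\<integral>\<^sup>+ s. e2ennreal (max 0 (S s)) \<partial>N) \<noteq> \<infinity>"
        using S_fin by (simp add: ext_integral_eq_PInf_iff)
      moreover have "(\<integral>\<^sup>+ s. ennreal (g0 s) \<partial>N) \<noteq> \<infinity>"
        using g0(1) by (simp add: real_integrable_def)
      ultimately show ?thesis
        by (simp add: less_top ennreal_mult_less_top)
    qed
    finally show ?thesis
      by (simp add: ext_integral_eq_PInf_iff)
  qed
  have real: "\<exists>g. integrable N g \<and> (AE s in N. \<Phi> a s = ereal (g s)) \<and>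
      ext_integral N (\<Phi> a) = ereal (\<integral>s. g s \<partial>N)"
    if "0 < a" "ext_integral N (\<Phi> a) \<noteq> \<infinity>" for a
    using ext_integral_finiteE[OF meas, of a] that low[of a] by (metis less_imp_le)
  have q_meas: "(\<lambda>s. diff_quot (\<lambda>a. \<Phi> a s) a) \<in> borel_measurable N" if "0 < a" for a
    using meas[of a] meas[of 0] that by simp
  have q_int: "\<exists>q. integrable N q \<and> (AE s in N. diff_quot (\<lambda>a. \<Phi> a s) a = ereal (q s)) \<and>
      diff_quot (\<lambda>a. ext_integral N (\<Phi> a)) a = ereal (\<integral>s. q s \<partial>N)"
    if a: "0 < a" and ne: "ext_integral N (\<Phi> a) \<noteq> \<infinity>" for a
  proof -
    obtain g where g: "integrable N g" "AE s in N. \<Phi> a s = ereal (g s)"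
        "ext_integral N (\<Phi> a) = ereal (\<integral>s. g s \<partial>N)"
      using real[OF a ne] by blast
    have "integrable N (\<lambda>s. (g s - g0 s) / a)"
      using g g0 by auto
    moreover have "AE s in N. diff_quot (\<lambda>a. \<Phi> a s) a = ereal ((g s - g0 s) / a)"
      using g(2) g0(2) by eventually_elim (use a in auto)
    moreover have "diff_quot (\<lambda>a. ext_integral N (\<Phi> a)) a = ereal (\<integral>s. (g s - g0 s) / a \<partial>N)"
      using a g g0 by simp
    ultimately show ?thesis by (intro exI[of _ "\<lambda>s. (g s - g0 s) / a"] conjI)
  qed
  show mono_int: "diff_quot (\<lambda>a. ext_integral N (\<Phi> a)) a \<le> diff_quot (\<lambda>a. ext_integral N (\<Phi> a)) b"
    if a: "0 < a" and ab: "a \<le> b" for a b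
  proof (cases "ext_integral N (\<Phi> b) = \<infinity>")
    case True
    then show ?thesis using g0(3) a ab by simp
  next
    case False
    have b: "0 < b" using a ab by simp
    obtain qb where qb: "integrable N qb" "AE s in N. diff_quot (\<lambda>a. \<Phi> a s) b = ereal (qb s)"
      "diff_quot (\<lambda>a. ext_integral N (\<Phi> a)) b = ereal (\<integral>s. qb s \<partial>N)"
      using q_int[OF b False] by auto
    have le: "AE s in N. diff_quot (\<lambda>a. \<Phi> a s) a \<le> diff_quot (\<lambda>a. \<Phi> a s) b"
      using mono by eventually_elim (use a ab in auto)
    have "ext_integral N (\<lambda>s. diff_quot (\<lambda>a. \<Phi> a s) b) \<noteq> \<infinity>"
      using ext_integral_cong_AE[OF qb(2)] ext_integral_ereal[OF qb(1)] by simp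
    from fin_pos[OF a q_meas[OF b] le this]
    obtain qa where qa: "integrable N qa" "AE s in N. diff_quot (\<lambda>a. \<Phi> a s) a = ereal (qa s)"
      "diff_quot (\<lambda>a. ext_integral N (\<Phi> a)) a = ereal (\<integral>s. qa s \<partial>N)"
      using q_int[OF a] by auto
    have "AE s in N. qa s \<le> qb s"
      using le qa(2) qb(2) by eventually_elim auto
    then have "(\<integral>s. qa s \<partial>N) \<le> (\<integral>s. qb s \<partial>N)"
      using qa(1) qb(1) by (intro integral_mono_AE)
    then show ?thesis using qa(3) qb(3) by simp
  qed
  \<comment> \<open>A countable supremum of measurable quotients, hence measurable; by monotonicity
    it agrees almost everywhere with the supremum over all positive reals.\<close>
  define S where "S s = (SUP n. diff_quot (\<lambda>a. \<Phi> a s) (real (Suc n)))" for s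
  have [measurable]: "S \<in> borel_measurable N"
    unfolding S_def by (intro borel_measurable_SUP q_meas) auto
  have "AE s in N. (SUP a\<in>{0<..}. diff_quot (\<lambda>a. \<Phi> a s) a) = S s"
    using mono unfolding S_def by eventually_elim (rule SUP_pos_eq_SUP_nat, blast)
  then have S_eq: "ext_integral N (\<lambda>s. SUP a\<in>{0<..}. diff_quot (\<lambda>a. \<Phi> a s) a) = ext_integral N S"
    by (rule ext_integral_cong_AE)
  have L_eq: "(SUP a\<in>{0<..}. diff_quot (\<lambda>a. ext_integral N (\<Phi> a)) a) =
      (SUP n. diff_quot (\<lambda>a. ext_integral N (\<Phi> a)) (real (Suc n)))"
    by (rule SUP_pos_eq_SUP_nat) (rule mono_int)
  have "ext_integral N S = (SUP n. diff_quot (\<lambda>a. ext_integral N (\<Phi> a)) (real (Suc n)))"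
  proof (cases "\<exists>n. ext_integral N (\<Phi> (real (Suc n))) = \<infinity>")
    case True
    then obtain n where n: "ext_integral N (\<Phi> (real (Suc n))) = \<infinity>" by blast
    have "AE s in N. diff_quot (\<lambda>a. \<Phi> a s) (real (Suc n)) \<le> S s"
      unfolding S_def by (intro AE_I2 SUP_upper) auto
    \<comment> \<open>Otherwise \<open>fin_pos\<close> with \<open>S\<close> as the upper bound
      would make the integral at this step finite from above.\<close>
    then have "ext_integral N S = \<infinity>"
      using fin_pos[of "real (Suc n)" S] n by auto
    moreover have "diff_quot (\<lambda>a. ext_integral N (\<Phi> a)) (real (Suc n)) = \<infinity>"
      unfolding n g0(3) by simp
    then have "(SUP n. diff_quot (\<lambda>a. ext_integral N (\<Phi> a)) (real (Suc n))) = \<infinity>"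
      by (metis (mono_tags, lifting) SUP_upper UNIV_I ereal_infty_less_eq(1))
    ultimately show ?thesis by simp
  next
    case False
    then have "\<forall>n. \<exists>q. integrable N q \<and> (AE s in N. diff_quot (\<lambda>a. \<Phi> a s) (real (Suc n)) = ereal (q s)) \<and>
      diff_quot (\<lambda>a. ext_integral N (\<Phi> a)) (real (Suc n)) = ereal (\<integral>s. q s \<partial>N)"
      by (intro allI q_int) auto
    then obtain q where q: "\<And>n. integrable N (q n)"
      "\<And>n. AE s in N. diff_quot (\<lambda>a. \<Phi> a s) (real (Suc n)) = ereal (q n s)"
      "\<And>n. diff_quot (\<lambda>a. ext_integral N (\<Phi> a)) (real (Suc n)) = ereal (\<integral>s. q n s \<partial>N)"
      by metis
    have [measurable]: "q n \<in> borel_measurable N" for n using q(1)[of n] by auto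
    have q_mono: "AE s in N. \<forall>m n. m \<le> n \<longrightarrow> q m s \<le> q n s"
    proof -
      have "AE s in N. \<forall>n. diff_quot (\<lambda>a. \<Phi> a s) (real (Suc n)) = ereal (q n s)"
        using q(2) by (simp add: AE_all_countable)
      then show ?thesis
        using mono
      proof eventually_elim
        case (elim s)
        show ?case
        proof (intro allI impI)
          fix m n :: nat assume "m \<le> n"
          then have "diff_quot (\<lambda>a. \<Phi> a s) (real (Suc m)) \<le> diff_quot (\<lambda>a. \<Phi> a s) (real (Suc n))"
            using elim(2) by auto
          then show "q m s \<le> q n s" using elim(1) by auto
        qed
      qed
    qed
    \<comment> \<open>Index 0 is step length 1. The differences to that quotient are nonnegative
      almost everywhere, so monotone convergence for nonnegative functions applies to them;
      \<open>q 0\<close> is integrable and is added back afterwards.\<close>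
    define r where "r n s = ennreal (q n s - q 0 s)" for n s
    have [measurable]: "r n \<in> borel_measurable N" for n unfolding r_def by measurable
    have r_int: "(\<integral>\<^sup>+ s. r n s \<partial>N) = ennreal ((\<integral>s. q n s \<partial>N) - (\<integral>s. q 0 s \<partial>N))" for n
      unfolding r_def using q(1) q_mono
      by (subst nn_integral_eq_integral) (auto elim!: eventually_mono)
    have q_int_mono: "(\<integral>s. q m s \<partial>N) \<le> (\<integral>s. q n s \<partial>N)" if "m \<le> n" for m n
      using q(1) q_mono that by (intro integral_mono_AE) (auto elim!: eventually_mono)
    have "AE s in N. S s = ereal (q 0 s) + enn2ereal (SUP n. r n s)"
    proof -
      have "AE s in N. \<forall>n. diff_quot (\<lambda>a. \<Phi> a s) (real (Suc n)) = ereal (q n s)"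
        using q(2) by (simp add: AE_all_countable)
      then show ?thesis
        using q_mono
      proof eventually_elim
        case (elim s)
        have "S s = (SUP n. ereal (q n s))"
          unfolding S_def using elim(1) by simp
        also have "\<dots> = (SUP n. ereal (q 0 s) + enn2ereal (r n s))"
          unfolding r_def using elim(2) by (intro SUP_cong) (auto simp: enn2ereal_ennreal)
        also have "\<dots> = ereal (q 0 s) + (SUP n. enn2ereal (r n s))"
          by (rule SUP_ereal_add_right) auto
        also have "(SUP n. enn2ereal (r n s)) = enn2ereal (SUP n. r n s)"
          by (simp add: enn2ereal_SUP)
        finally show ?case .
      qed
    qed
    then have "ext_integral N S = ext_integral N (\<lambda>s. ereal (q 0 s) + enn2ereal (SUP n. r n s))"
      by (rule ext_integral_cong_AE)
    also have "\<dots> = ereal (\<integral>s. q 0 s \<partial>N) + enn2ereal (\<integral>\<^sup>+ s. (SUP n. r n s) \<partial>N)"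
      by (rule ext_integral_add_nonneg[OF q(1)]) measurable
    also have "(\<integral>\<^sup>+ s. (SUP n. r n s) \<partial>N) = (SUP n. \<integral>\<^sup>+ s. r n s \<partial>N)"
    proof (rule nn_integral_monotone_convergence_SUP_AE)
      show "AE s in N. r n s \<le> r (Suc n) s" for n
        using q_mono by eventually_elim (auto simp: r_def intro!: ennreal_leI)
    qed simp
    also have "ereal (\<integral>s. q 0 s \<partial>N) + enn2ereal (SUP n. \<integral>\<^sup>+ s. r n s \<partial>N) =
        (SUP n. ereal (\<integral>s. q 0 s \<partial>N) + enn2ereal (\<integral>\<^sup>+ s. r n s \<partial>N))"
      by (subst SUP_ereal_add_right) (auto simp: enn2ereal_SUP)
    also have "\<dots> = (SUP n. ereal (\<integral>s. q n s \<partial>N))"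
      unfolding r_int using q_int_mono by (intro SUP_cong) (auto simp: enn2ereal_ennreal)
    finally show ?thesis by (simp only: q(3))
  qed
  then show "(SUP a\<in>{0<..}. diff_quot (\<lambda>a. ext_integral N (\<Phi> a)) a) =
      ext_integral N (\<lambda>s. SUP a\<in>{0<..}. diff_quot (\<lambda>a. \<Phi> a s) a)"
    using S_eq L_eq by simp
qed

section \<open>Recession functions\<close>

text \<open>Working with real upper bounds instead of the values keeps undefined sums such as
  \<infinity> - \<infinity> out of the convexity inequality, even where \<open>g\<close> is
  infinite.\<close>

lemma convex_epiD:
  assumes "convex (epi g)" and "g x \<le> ereal r" "g y \<le> ereal r'" and "0 \<le> l" "l \<le> 1"
  shows "g ((1 - l) *\<^sub>R x + l *\<^sub>R y) \<le> ereal ((1 - l) * r + l * r')"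
proof -
  have "(1 - l) *\<^sub>R (x, r) + l *\<^sub>R (y, r') \<in> epi g"
    using assms by (intro convexD_alt) (auto simp: epi_def)
  then show ?thesis by (simp add: epi_def)
qed

text \<open>The point at step \<open>a\<close> is the convex combination of the base point and the
  point at step \<open>c\<close> with weight \<open>a / c\<close> on the latter. The value
  -\<infinity> at step \<open>c\<close> is allowed and is then inherited at step
  \<open>a\<close>.\<close>

lemma diff_quot_mono:
  fixes g :: "'v::real_vector \<Rightarrow> ereal"
  assumes cvx: "convex (epi g)" and b: "g b = ereal r" and ac: "0 < a" "a \<le> c"
  shows "diff_quot (\<lambda>a. g (b + a *\<^sub>R u)) a \<le> diff_quot (\<lambda>a. g (b + a *\<^sub>R u)) c"
proof -
  have c: "0 < c" using ac by simp
  define l where "l = a / c"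
  have l: "0 < l" "l \<le> 1" "a = l * c" using ac c by (auto simp: l_def)
  have eq: "(1 - l) *\<^sub>R b + l *\<^sub>R (b + c *\<^sub>R u) = b + a *\<^sub>R u"
    using l(3) by (simp add: algebra_simps)
  have bound: "g (b + a *\<^sub>R u) \<le> ereal ((1 - l) * r + l * s)" if "g (b + c *\<^sub>R u) \<le> ereal s" for s
    using convex_epiD[OF cvx, of b r "b + c *\<^sub>R u" s l] b that l unfolding eq by auto
  show ?thesis
  proof (cases "g (b + c *\<^sub>R u)")
    case (real s)
    have "g (b + a *\<^sub>R u) - ereal r \<le> ereal (l * (s - r))"
    proof (cases "g (b + a *\<^sub>R u)")
      case (real s')
      then show ?thesis using bound[of s] \<open>g (b + c *\<^sub>R u) = ereal s\<close> by (simp add: algebra_simps)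
    qed (use bound[of s] real in auto)
    then have "(g (b + a *\<^sub>R u) - ereal r) / ereal a \<le> ereal (l * (s - r)) / ereal a"
      using ac by (intro ereal_divide_right_mono) auto
    also have "\<dots> = ereal ((s - r) / c)"
      using ac c by (simp add: l_def)
    finally show ?thesis using real b c by simp
  next
    case PInf
    then show ?thesis using b c by simp
  next
    case MInf
    \<comment> \<open>The bound at step \<open>c\<close> is chosen so that its combination with
      \<open>r\<close> is exactly \<open>s\<close>; any real number is admissible there because the
      value is -\<infinity>.\<close>
    have "g (b + a *\<^sub>R u) \<le> ereal s" for s
      using bound[of "(s - (1 - l) * r) / l"] MInf l by simp
    then have "g (b + a *\<^sub>R u) = -\<infinity>"
      by (rule ereal_bot)
    then show ?thesis using b ac by simp
  qed
qed

text \<open>A finite recession value \<open>L\<close> at \<open>b\<close> bounds \<open>g\<close> by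
  an affine function of slope \<open>L\<close> along the ray from \<open>b\<close>. Joining
  (\<open>b'\<close>, \<open>r'\<close>) to ever more distant points of that affine ray and passing
  to the limit in the closed epigraph transfers the bound to the parallel ray from
  \<open>b'\<close>.\<close>

lemma recession_at_bound:
  fixes g :: "'v::real_normed_vector \<Rightarrow> ereal"
  assumes cvx: "convex (epi g)" and cl: "closed (epi g)" and proper: "\<And>y. g y \<noteq> -\<infinity>"
    and b: "g b = ereal r" and b': "g b' = ereal r'"
  shows "recession_at g b' u \<le> recession_at g b u"
proof (cases "recession_at g b u = \<infinity>")
  case False
  have q: "diff_quot (\<lambda>a. g (b + a *\<^sub>R u)) a \<le> recession_at g b u" if "0 < a" for a
    unfolding recession_at_def using that by (intro SUP_upper2[of a]) auto
  \<comment> \<open>The quotient at step 1 is a lower bound, and it exceeds -\<infinity> as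
    \<open>g\<close> never takes that value.\<close>
  have "recession_at g b u \<noteq> -\<infinity>"
    using q[of 1] b proper[of "b + u"] by (cases "g (b + u)") (auto simp: one_ereal_def[symmetric])
  with False obtain L where L: "recession_at g b u = ereal L"
    by (cases "recession_at g b u") auto
  have line: "g (b + a *\<^sub>R u) \<le> ereal (r + a * L)" if "0 < a" for a
    using q[OF that] L b that by (cases "g (b + a *\<^sub>R u)") (auto simp: field_simps)
  have "g (b' + a *\<^sub>R u) \<le> ereal (r' + a * L)" if a: "0 < a" for a
  proof -
    \<comment> \<open>The weight \<open>l\<close> tends to 0 while the far point sits at step
      \<open>a / l\<close>, so the displacement in direction \<open>u\<close> is always
      \<open>a\<close>. What remains is an error of \<open>l\<close> times (\<open>b - b'\<close>,
      \<open>r - r'\<close>), which vanishes in the limit.\<close>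
    define p where "p n = (let l = inverse (real (Suc n)) in
      (1 - l) *\<^sub>R (b', r') + l *\<^sub>R (b + (a / l) *\<^sub>R u, r + (a / l) * L))" for n
    have "p n \<in> epi g" for n
    proof -
      have "g (b + (a / inverse (real (Suc n))) *\<^sub>R u) \<le> ereal (r + (a / inverse (real (Suc n))) * L)"
        using a by (intro line) simp
      then show ?thesis
        unfolding p_def Let_def using cvx b'
        by (intro convexD_alt) (auto simp: epi_def inverse_le_1_iff)
    qed
    moreover have "p \<longlonglongrightarrow> (b' + a *\<^sub>R u, r' + a * L)"
    proof -
      have p_eq: "p n = (b' + a *\<^sub>R u, r' + a * L) + inverse (real (Suc n)) *\<^sub>R (b - b', r - r')" for n
        unfolding p_def Let_def by (auto simp: algebra_simps)
      have "(\<lambda>n. (b' + a *\<^sub>R u, r' + a * L) + inverse (real (Suc n)) *\<^sub>R (b - b', r - r'))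
          \<longlonglongrightarrow> (b' + a *\<^sub>R u, r' + a * L) + 0 *\<^sub>R (b - b', r - r')"
        by (intro tendsto_intros LIMSEQ_inverse_real_of_nat)
      then show ?thesis by (simp add: p_eq[abs_def])
    qed
    ultimately have "(b' + a *\<^sub>R u, r' + a * L) \<in> epi g"
      using cl closed_sequentially by blast
    then show ?thesis by (simp add: epi_def)
  qed
  then have "diff_quot (\<lambda>a. g (b' + a *\<^sub>R u)) a \<le> ereal L" if "0 < a" for a
  proof -
    assume "\<And>a. 0 < a \<Longrightarrow> g (b' + a *\<^sub>R u) \<le> ereal (r' + a * L)"
    with that have "g (b' + a *\<^sub>R u) \<le> ereal (r' + a * L)" by blast
    then show ?thesis
      using b' that by (cases "g (b' + a *\<^sub>R u)") (auto simp: field_simps)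
  qed
  then show ?thesis
    unfolding L by (subst recession_at_def) (auto intro!: SUP_least)
qed simp

text \<open>The point \<open>b\<close> shows that the choice in \<open>recession\<close> picks a
  base point with a finite value; the preceding bound in both directions then makes the two base
  points equivalent.\<close>

lemma recession_eq_recession_at:
  fixes g :: "'v::real_normed_vector \<Rightarrow> ereal"
  assumes "convex (epi g)" "closed (epi g)" "\<And>y. g y \<noteq> -\<infinity>" "g b = ereal r"
  shows "recession g u = recession_at g b u"
proof -
  define b' where "b' = (SOME b. g b \<noteq> \<infinity> \<and> g b \<noteq> -\<infinity>)"
  have "g b' \<noteq> \<infinity> \<and> g b' \<noteq> -\<infinity>"
    unfolding b'_def by (rule someI[of _ b]) (simp add: assms(4))
  then obtain r' where "g b' = ereal r'" by (cases "g b'") auto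
  then show ?thesis
    unfolding recession_def b'_def[symmetric]
    using recession_at_bound[OF assms(1-3)] assms(4) by (blast intro: antisym)
qed

section \<open>Sums of difference quotients\<close>

text \<open>Along the integers the three functions are increasing sequences that avoid -\<infinity>,
  and for such sequences the supremum of a sum is the sum of the suprema.\<close>

lemma SUP_add3_pos:
  fixes p q r :: "real \<Rightarrow> ereal"
  assumes mono: "\<And>a b. 0 < a \<Longrightarrow> a \<le> b \<Longrightarrow> p a \<le> p b" "\<And>a b. 0 < a \<Longrightarrow> a \<le> b \<Longrightarrow> q a \<le> q b"
      "\<And>a b. 0 < a \<Longrightarrow> a \<le> b \<Longrightarrow> r a \<le> r b"
    and proper: "\<And>a. 0 < a \<Longrightarrow> p a \<noteq> -\<infinity>" "\<And>a. 0 < a \<Longrightarrow> q a \<noteq> -\<infinity>" "\<And>a. 0 < a \<Longrightarrow> r a \<noteq> -\<infinity>"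
  shows "(SUP a\<in>{0<..}. p a + q a + r a) = (SUP a\<in>{0<..}. p a) + (SUP a\<in>{0<..}. q a) + (SUP a\<in>{0<..}. r a)"
proof -
  have inc: "incseq (\<lambda>n. f (real (Suc n)))" if "\<And>a b. 0 < a \<Longrightarrow> a \<le> b \<Longrightarrow> f a \<le> f b" for f :: "real \<Rightarrow> ereal"
    using that by (auto simp: incseq_def)
  have "(SUP a\<in>{0<..}. p a + q a + r a) = (SUP n. p (real (Suc n)) + q (real (Suc n)) + r (real (Suc n)))"
    by (rule SUP_pos_eq_SUP_nat) (intro add_mono mono)
  also have "\<dots> = (SUP n. p (real (Suc n)) + q (real (Suc n))) + (SUP n. r (real (Suc n)))"
    using proper by (intro SUP_ereal_add inc[of r] mono inc[of "\<lambda>a. p a + q a"] add_mono) auto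
  also have "(SUP n. p (real (Suc n)) + q (real (Suc n))) = (SUP n. p (real (Suc n))) + (SUP n. q (real (Suc n)))"
    using proper by (intro SUP_ereal_add inc[of p] inc[of q] mono) auto
  finally show ?thesis
    using mono by (simp only: SUP_pos_eq_SUP_nat)
qed

lemma diff_quot_add3:
  fixes p q r :: "real \<Rightarrow> ereal"
  assumes "p 0 = ereal p0" "q 0 = ereal q0" "r 0 = ereal r0" "0 < a"
    and "p a \<noteq> -\<infinity>" "q a \<noteq> -\<infinity>" "r a \<noteq> -\<infinity>"
  shows "diff_quot (\<lambda>a. p a + q a + r a) a = diff_quot p a + diff_quot q a + diff_quot r a"
  using assms by (cases "p a"; cases "q a"; cases "r a") (auto simp: field_simps)

text \<open>Fitted to the three terms of \<open>f_int\<close>: with real base values and no value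
  -\<infinity> the quotients add up, and monotonicity and suprema follow termwise.\<close>

lemma diff_quot_add3_SUP:
  fixes p q r :: "real \<Rightarrow> ereal"
  assumes p: "p 0 = ereal p0" "\<And>a. 0 < a \<Longrightarrow> p a \<noteq> -\<infinity>" "\<And>a b. 0 < a \<Longrightarrow> a \<le> b \<Longrightarrow> diff_quot p a \<le> diff_quot p b"
    and q: "q 0 = ereal q0" "\<And>a. 0 < a \<Longrightarrow> q a \<noteq> -\<infinity>" "\<And>a b. 0 < a \<Longrightarrow> a \<le> b \<Longrightarrow> diff_quot q a \<le> diff_quot q b"
    and r: "r 0 = ereal r0" "\<And>a. 0 < a \<Longrightarrow> r a \<noteq> -\<infinity>" "\<And>a b. 0 < a \<Longrightarrow> a \<le> b \<Longrightarrow> diff_quot r a \<le> diff_quot r b"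
  shows diff_quot_add3_mono: "0 < a \<Longrightarrow> a \<le> b \<Longrightarrow> diff_quot (\<lambda>a. p a + q a + r a) a \<le> diff_quot (\<lambda>a. p a + q a + r a) b"
    and SUP_diff_quot_add3: "(SUP a\<in>{0<..}. diff_quot (\<lambda>a. p a + q a + r a) a) =
      (SUP a\<in>{0<..}. diff_quot p a) + (SUP a\<in>{0<..}. diff_quot q a) + (SUP a\<in>{0<..}. diff_quot r a)"
proof -
  have add: "diff_quot (\<lambda>a. p a + q a + r a) a = diff_quot p a + diff_quot q a + diff_quot r a" if "0 < a" for a
    by (rule diff_quot_add3[OF p(1) q(1) r(1) that p(2)[OF that] q(2)[OF that] r(2)[OF that]])
  have fin: "diff_quot f a \<noteq> -\<infinity>" if "0 < a" "f 0 = ereal c" "f a \<noteq> -\<infinity>" for f c a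
    using that by (cases "f a") auto
  show "diff_quot (\<lambda>a. p a + q a + r a) a \<le> diff_quot (\<lambda>a. p a + q a + r a) b" if "0 < a" "a \<le> b" for a b
  proof -
    have "0 < b" using that by simp
    then show ?thesis
      unfolding add[OF that(1)] add[OF \<open>0 < b\<close>]
      by (intro add_mono p(3)[OF that] q(3)[OF that] r(3)[OF that])
  qed
  have "(SUP a\<in>{0<..}. diff_quot (\<lambda>a. p a + q a + r a) a) = (SUP a\<in>{0<..}. diff_quot p a + diff_quot q a + diff_quot r a)"
    using add by (intro SUP_cong) auto
  also have "\<dots> = (SUP a\<in>{0<..}. diff_quot p a) + (SUP a\<in>{0<..}. diff_quot q a) + (SUP a\<in>{0<..}. diff_quot r a)"
  proof (rule SUP_add3_pos)
    fix a :: real assume "0 < a"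
    note a = this
    show "diff_quot p a \<noteq> -\<infinity>" by (rule fin[OF a p(1) p(2)[OF a]])
    show "diff_quot q a \<noteq> -\<infinity>" by (rule fin[OF a q(1) q(2)[OF a]])
    show "diff_quot r a \<noteq> -\<infinity>" by (rule fin[OF a r(1) r(2)[OF a]])
  qed (fact p(3) q(3) r(3))+
  finally show "(SUP a\<in>{0<..}. diff_quot (\<lambda>a. p a + q a + r a) a) =
      (SUP a\<in>{0<..}. diff_quot p a) + (SUP a\<in>{0<..}. diff_quot q a) + (SUP a\<in>{0<..}. diff_quot r a)" .
qed

section \<open>Normal integrands and measurability\<close>

text \<open>Only the hitting sets of the epigraph involve the sigma-algebra. This carries
  predictable, initial and terminal integrands over to the larger sigma-algebras used for
  integration.\<close>

lemma normal_integrand_mono: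
  assumes "normal_integrand S g" "space S' = space S" "sets S \<subseteq> sets S'"
  shows "normal_integrand S' g"
  using assms(1,3) unfolding normal_integrand_def assms(2) by blast

text \<open>The value is at most \<open>c\<close> exactly when (\<open>z s\<close>,
  \<open>c\<close>) lies in the closed epigraph. This is tested with countably many points: for
  every \<open>n\<close> some \<open>q\<close> of a countable dense set is within
  \<open>1/(n+1)\<close> of (\<open>z s\<close>, \<open>c\<close>) and its ball of that radius meets
  the epigraph.\<close>

lemma borel_measurable_normal_integrand:
  fixes g :: "'s \<Rightarrow> 'v::euclidean_space \<Rightarrow> ereal"
  assumes ni: "normal_integrand S g" and [measurable]: "z \<in> borel_measurable S"
  shows "(\<lambda>s. g s (z s)) \<in> borel_measurable S"
proof -
  obtain D :: "('v \<times> real) set" where D: "countable D" "\<And>X. open X \<Longrightarrow> X \<noteq> {} \<Longrightarrow> \<exists>d\<in>D. d \<in> X"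
    using countable_dense_exists by blast
  have "{s\<in>space S. g s (z s) \<le> ereal c} \<in> sets S" for c
  proof -
    have cond: "g s (z s) \<le> ereal c \<longleftrightarrow> (\<forall>n. \<exists>q\<in>D. dist q (z s, c) < inverse (real (Suc n)) \<and>
        epi (g s) \<inter> ball q (inverse (real (Suc n))) \<noteq> {})" (is "_ \<longleftrightarrow> ?R")
      if "s \<in> space S" for s
    proof
      assume "g s (z s) \<le> ereal c"
      then have "(z s, c) \<in> epi (g s)" by (simp add: epi_def)
      moreover have "\<exists>q\<in>D. q \<in> ball (z s, c) (inverse (real (Suc n)))" for n
        by (intro D(2)) auto
      ultimately show ?R
        by (metis (no_types, lifting) IntI dist_commute empty_iff mem_ball)
    next
      assume R: ?R
      have "\<exists>e\<in>epi (g s). dist e (z s, c) < r" if "0 < r" for r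
      proof -
        \<comment> \<open>The triangle inequality through \<open>q\<close> costs the radius twice,
          hence the half of \<open>r\<close>.\<close>
        from that obtain n where n: "inverse (real (Suc n)) < r / 2"
          using reals_Archimedean[of "r / 2"] by auto
        from R obtain q e where "dist q (z s, c) < inverse (real (Suc n))"
          "e \<in> epi (g s)" "dist q e < inverse (real (Suc n))"
          by (metis (no_types, lifting) IntE ex_in_conv mem_ball)
        moreover have "dist e (z s, c) \<le> dist q e + dist q (z s, c)"
          by (metis dist_commute dist_triangle)
        ultimately show ?thesis using n by (intro bexI[of _ e]) auto
      qed
      then have "(z s, c) \<in> closure (epi (g s))"
        by (auto simp: closure_approachable)
      then show "g s (z s) \<le> ereal c"
        using ni that by (auto simp: normal_integrand_def epi_def)
    qed
    have "{s\<in>space S. g s (z s) \<le> ereal c} =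
      {s\<in>space S. \<forall>n. \<exists>q\<in>D. dist q (z s, c) < inverse (real (Suc n)) \<and>
        epi (g s) \<inter> ball q (inverse (real (Suc n))) \<noteq> {}}"
      using cond by blast
    also have "\<dots> \<in> sets S"
    proof (intro sets.sets_Collect_countable_All sets.sets_Collect_countable_Ex' D(1) sets.sets_Collect_conj)
      fix n q
      show "{s\<in>space S. dist q (z s, c) < inverse (real (Suc n))} \<in> sets S"
        by measurable
      show "{s\<in>space S. epi (g s) \<inter> ball q (inverse (real (Suc n))) \<noteq> {}} \<in> sets S"
        using ni by (simp add: normal_integrand_def)
    qed
    finally show ?thesis .
  qed
  note sets_real = this
  \<comment> \<open>Infinite levels: -\<infinity> is reached as a countable intersection of the
    levels \<open>- n\<close>, and the level \<infinity> gives the whole space.\<close>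
  have "{s\<in>space S. g s (z s) \<le> c} \<in> sets S" for c
  proof (cases c)
    case MInf
    have "{s\<in>space S. g s (z s) \<le> c} = {s\<in>space S. \<forall>n::nat. g s (z s) \<le> ereal (- real n)}"
    proof -
      have "e = -\<infinity>" if "\<forall>n::nat. e \<le> ereal (- real n)" for e
      proof (cases e)
        case (real r)
        obtain n where "- r < real n" using reals_Archimedean2 by blast
        with that[rule_format, of n] \<open>e = ereal r\<close> show ?thesis by simp
      next
        case PInf
        with that[rule_format, of 0] show ?thesis by simp
      qed
      then show ?thesis unfolding MInf by auto
    qed
    also have "\<dots> \<in> sets S"
      by (intro sets.sets_Collect_countable_All sets_real)
    finally show ?thesis .
  qed (use sets_real in auto)
  then show ?thesis
    by (rule borel_measurableI_le)
qed

text \<open>A single value -\<infinity> of \<open>k \<omega>\<close> makes its conjugate identically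
  \<infinity>, which on a set of positive measure contradicts the assumption on the integral. The
  result gives the pointwise properness behind base point independence.\<close>

lemma AE_normal_integrand_neq_MInf:
  fixes k :: "'w \<Rightarrow> 'v::euclidean_space \<Rightarrow> ereal"
  assumes ni: "normal_integrand M k"
    and fin: "ext_integral M (\<lambda>\<omega>. conjugate (k \<omega>) (y \<omega>)) \<noteq> \<infinity>"
  shows "AE \<omega> in M. \<forall>x. k \<omega> x \<noteq> -\<infinity>"
proof -
  \<comment> \<open>the bad points lie in this measurable set, on which the conjugate is \<open>\<infinity>\<close>; this avoids measurability of the conjugate itself\<close>
  define B where "B = (\<Union>j. \<Inter>n. {\<omega>\<in>space M. epi (k \<omega>) \<inter> (ball 0 (real j) \<times> {..<- real n}) \<noteq> {}})"
  have "{\<omega>\<in>space M. epi (k \<omega>) \<inter> (ball 0 (real j) \<times> {..<- real n}) \<noteq> {}} \<in> sets M" for j n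
    using ni by (simp add: normal_integrand_def open_Times)
  then have B[measurable]: "B \<in> sets M"
    unfolding B_def by (intro sets.countable_UN sets.countable_INT image_subsetI) auto
  have conj: "conjugate (k \<omega>) (y \<omega>) = \<infinity>" if w: "\<omega> \<in> B" for \<omega>
  proof -
    obtain j where j: "\<And>n. epi (k \<omega>) \<inter> (ball 0 (real j) \<times> {..<- real n}) \<noteq> {}"
      using w by (auto simp: B_def)
    have "ereal c \<le> conjugate (k \<omega>) (y \<omega>)" for c
    proof -
      \<comment> \<open>By Cauchy-Schwarz the inner product on the ball of radius \<open>j\<close>
        is at least \<open>- j * norm (y \<omega>)\<close>; with \<open>a < - n\<close> this
        \<open>n\<close> lifts the difference above \<open>c\<close>.\<close>
      obtain n where n: "c + real j * norm (y \<omega>) \<le> real n" using real_arch_simple by blast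
      obtain x a where xa: "k \<omega> x \<le> ereal a" "norm x < real j" "a < - real n"
        using j[of n] by (auto simp: epi_def)
      have "\<bar>x \<bullet> y \<omega>\<bar> \<le> norm x * norm (y \<omega>)" by (rule Cauchy_Schwarz_ineq2)
      also have "\<dots> \<le> real j * norm (y \<omega>)" using xa by (intro mult_right_mono) auto
      finally have "c \<le> x \<bullet> y \<omega> - a" using n xa by linarith
      then have "ereal c \<le> ereal (x \<bullet> y \<omega>) - k \<omega> x"
        using xa(1) by (cases "k \<omega> x") auto
      then show ?thesis unfolding conjugate_def by (rule SUP_upper2[OF UNIV_I])
    qed
    then show ?thesis by (rule ereal_top)
  qed
  have "\<infinity> * emeasure M B = (\<integral>\<^sup>+ \<omega>. \<infinity> * indicator B \<omega> \<partial>M)"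
    by (simp add: nn_integral_cmult_indicator)
  also have "\<dots> \<le> (\<integral>\<^sup>+ \<omega>. e2ennreal (max 0 (conjugate (k \<omega>) (y \<omega>))) \<partial>M)"
    using conj by (intro nn_integral_mono) (auto split: split_indicator simp: max_def)
  also have "\<dots> < \<infinity>"
    using fin by (simp add: ext_integral_eq_PInf_iff less_top)
  finally have "emeasure M B = 0"
    by (auto simp: ennreal_top_mult split: if_splits)
  then have "AE \<omega> in M. \<omega> \<notin> B"
    by (intro AE_not_in) (simp add: null_setsI)
  then show ?thesis
    using AE_space
  proof eventually_elim
    case (elim \<omega>)
    show ?case
    proof (intro allI notI)
      fix x assume "k \<omega> x = -\<infinity>"
      moreover obtain j where "norm x < real j" using reals_Archimedean2 by blast
      ultimately have "(x, - real n - 1) \<in> epi (k \<omega>) \<inter> (ball 0 (real j) \<times> {..<- real n})" for n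
        by (simp add: epi_def)
      then have "epi (k \<omega>) \<inter> (ball 0 (real j) \<times> {..<- real n}) \<noteq> {}" for n
        by (metis empty_iff)
      then have "\<omega> \<in> B"
        unfolding B_def using elim(2) by (intro UN_I[of j] INT_I CollectI conjI) auto
      then show False
        using elim(1) by simp
    qed
  qed
qed

section \<open>Random measures and left-continuous processes\<close>

text \<open>Dividing a finite kernel by its total mass gives a subprobability kernel, for which
  measurability of integrals is known; multiplying by the mass recovers the original
  integral.\<close>

lemma borel_measurable_nn_integral_kernel:
  assumes sets: "\<And>\<omega>. \<omega> \<in> space M \<Longrightarrow> sets (\<kappa> \<omega>) = sets R"
    and fin: "\<And>\<omega>. \<omega> \<in> space M \<Longrightarrow> emeasure (\<kappa> \<omega>) (space R) < \<infinity>"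
    and meas: "\<And>A. A \<in> sets R \<Longrightarrow> (\<lambda>\<omega>. emeasure (\<kappa> \<omega>) A) \<in> borel_measurable M"
    and ne: "space R \<noteq> {}"
    and f: "(\<lambda>(\<omega>, t). f \<omega> t) \<in> borel_measurable (M \<Otimes>\<^sub>M R)"
  shows "(\<lambda>\<omega>. \<integral>\<^sup>+ t. f \<omega> t \<partial>\<kappa> \<omega>) \<in> borel_measurable M"
proof -
  define c where "c \<omega> = emeasure (\<kappa> \<omega>) (space R)" for \<omega>
  \<comment> \<open>Where the mass is 0 the scaling factor is \<infinity>, but
    \<open>\<kappa> \<omega>\<close> is then the null measure and so is \<open>L \<omega>\<close>,
    because \<infinity> times 0 is 0 in \<open>ennreal\<close>.\<close>
  define L where "L \<omega> = scale_measure (inverse (c \<omega>)) (\<kappa> \<omega>)" for \<omega>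
  have [measurable]: "c \<in> borel_measurable M"
    unfolding c_def by (rule meas) simp
  have space: "space (\<kappa> \<omega>) = space R" if "\<omega> \<in> space M" for \<omega>
    using sets[OF that] by (rule sets_eq_imp_space_eq)
  have inv_mult: "c \<omega> * inverse (c \<omega>) = 1" if "c \<omega> \<noteq> 0" "\<omega> \<in> space M" for \<omega>
    using that fin[of \<omega>] by (metis c_def ennreal_divide_self divide_ennreal_def infinity_ennreal_def less_irrefl)
  have L: "L \<in> M \<rightarrow>\<^sub>M subprob_algebra R"
  proof (rule measurable_subprob_algebra)
    fix \<omega> assume w: "\<omega> \<in> space M"
    show "subprob_space (L \<omega>)"
    proof
      show "emeasure (L \<omega>) (space (L \<omega>)) \<le> 1"
        using inv_mult[of \<omega>] w
        by (cases "c \<omega> = 0") (auto simp: L_def space_scale_measure space c_def[symmetric] mult.commute)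
      show "space (L \<omega>) \<noteq> {}"
        using w ne by (simp add: L_def space_scale_measure space)
    qed
    show "sets (L \<omega>) = sets R" using sets[OF w] by (simp add: L_def)
  next
    fix A assume "A \<in> sets R"
    then have [measurable]: "(\<lambda>\<omega>. emeasure (\<kappa> \<omega>) A) \<in> borel_measurable M" by (rule meas)
    show "(\<lambda>\<omega>. emeasure (L \<omega>) A) \<in> borel_measurable M"
      unfolding L_def by simp
  qed
  have [measurable]: "(\<lambda>\<omega>. \<integral>\<^sup>+ t. f \<omega> t \<partial>L \<omega>) \<in> borel_measurable M"
    by (rule nn_integral_measurable_subprob_algebra2[OF f L])
  have "(\<integral>\<^sup>+ t. f \<omega> t \<partial>\<kappa> \<omega>) = c \<omega> * (\<integral>\<^sup>+ t. f \<omega> t \<partial>L \<omega>)" if w: "\<omega> \<in> space M" for \<omega>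
  proof -
    have "f \<omega> \<in> borel_measurable R"
      using measurable_Pair2[OF f w] by simp
    then have m: "f \<omega> \<in> borel_measurable (\<kappa> \<omega>)"
      using sets[OF w] by (simp cong: measurable_cong_sets)
    have "c \<omega> * (\<integral>\<^sup>+ t. f \<omega> t \<partial>L \<omega>) = (c \<omega> * inverse (c \<omega>)) * (\<integral>\<^sup>+ t. f \<omega> t \<partial>\<kappa> \<omega>)"
      unfolding L_def by (simp add: nn_integral_scale_measure[OF m] mult.assoc)
    also have "\<dots> = (\<integral>\<^sup>+ t. f \<omega> t \<partial>\<kappa> \<omega>)"
    proof (cases "c \<omega> = 0")
      case True
      then have "space (\<kappa> \<omega>) \<in> null_sets (\<kappa> \<omega>)"
        using w sets.top[of "\<kappa> \<omega>"] by (auto simp: c_def space null_sets_def)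
      then have "AE t in \<kappa> \<omega>. False"
        by (intro AE_I'[of "space (\<kappa> \<omega>)"]) auto
      then have "(\<integral>\<^sup>+ t. f \<omega> t \<partial>\<kappa> \<omega>) = (\<integral>\<^sup>+ t. 0 \<partial>\<kappa> \<omega>)"
        by (intro nn_integral_cong_AE) auto
      then show ?thesis by simp
    qed (use inv_mult w in simp)
    finally show ?thesis by simp
  qed
  then show ?thesis
    by (subst measurable_cong[where g = "\<lambda>\<omega>. c \<omega> * (\<integral>\<^sup>+ t. f \<omega> t \<partial>L \<omega>)"]) auto
qed

text \<open>The process is the pointwise limit of processes that freeze its value at the last grid
  point before \<open>t\<close>; each of these uses countably many times and is jointly
  measurable.\<close>

lemma borel_measurable_left_continuous_process:
  fixes X :: "'w \<Rightarrow> real \<Rightarrow> 'b::{metric_space, second_countable_topology}"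
  assumes meas: "\<And>s. 0 \<le> s \<Longrightarrow> (\<lambda>\<omega>. X \<omega> s) \<in> borel_measurable M"
    and cont: "\<And>\<omega> t. \<omega> \<in> space M \<Longrightarrow> 0 < t \<Longrightarrow> continuous (at_left t) (X \<omega>)"
  shows "(\<lambda>p. X (fst p) (snd p)) \<in> borel_measurable (M \<Otimes>\<^sub>M restrict_space borel {0..T::real})"
    (is "_ \<in> borel_measurable ?P")
proof -
  \<comment> \<open>The ceiling minus one gives a grid point strictly below \<open>t\<close> for
    \<open>t > 0\<close>, as convergence along \<open>at_left\<close> requires. At
    \<open>t = 0\<close> the maximum returns 0, so the value there is exact.\<close>
  define s where "s n t = max 0 ((real_of_int \<lceil>real (Suc n) * t\<rceil> - 1) / real (Suc n))" for n t
  have sp: "p \<in> space ?P \<longleftrightarrow> fst p \<in> space M \<and> 0 \<le> snd p \<and> snd p \<le> T" for p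
    by (cases p) (auto simp: space_pair_measure space_restrict_space)
  have snd[measurable]: "(\<lambda>p. snd p) \<in> borel_measurable ?P"
    by (rule measurable_compose[OF measurable_snd]) (simp add: measurable_restrict_space1)
  have "(\<lambda>p. X (fst p) (s n (snd p))) \<in> borel_measurable ?P" for n
  proof -
    have "(\<lambda>p. X (fst p) (max 0 ((real_of_int i - 1) / real (Suc n)))) \<in> borel_measurable ?P" for i
      by (rule measurable_compose[OF measurable_fst meas]) simp
    moreover have "(\<lambda>p. \<lceil>real (Suc n) * snd p\<rceil>) \<in> ?P \<rightarrow>\<^sub>M count_space UNIV"
      by measurable
    ultimately show ?thesis
      unfolding s_def by (rule measurable_compose_countable)
  qed
  moreover have "(\<lambda>n. X (fst p) (s n (snd p))) \<longlonglongrightarrow> X (fst p) (snd p)" if "p \<in> space ?P" for p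
  proof (cases "snd p = 0")
    case True
    then show ?thesis by (simp add: s_def max_def)
  next
    case False
    then have t: "0 < snd p" and w: "fst p \<in> space M" using that by (auto simp: sp)
    have upper: "s n (snd p) < snd p" for n
    proof -
      have "(real_of_int \<lceil>real (Suc n) * snd p\<rceil> - 1) < real (Suc n) * snd p" by linarith
      then show ?thesis using t by (simp add: s_def divide_less_eq mult.commute)
    qed
    have lower: "snd p - inverse (real (Suc n)) \<le> s n (snd p)" for n
    proof -
      have "(real (Suc n) * snd p - 1) / real (Suc n) \<le> (real_of_int \<lceil>real (Suc n) * snd p\<rceil> - 1) / real (Suc n)"
        by (intro divide_right_mono) linarith+
      moreover have "(real (Suc n) * snd p - 1) / real (Suc n) = snd p - inverse (real (Suc n))"
        by (simp add: field_simps)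
      ultimately show ?thesis by (simp add: s_def)
    qed
    have "(\<lambda>n. s n (snd p)) \<longlonglongrightarrow> snd p"
    proof (rule tendsto_sandwich)
      show "\<forall>\<^sub>F n in sequentially. snd p - inverse (real (Suc n)) \<le> s n (snd p)"
        using lower by simp
      show "\<forall>\<^sub>F n in sequentially. s n (snd p) \<le> snd p"
        using upper by (simp add: less_imp_le)
      show "(\<lambda>n. snd p - inverse (real (Suc n))) \<longlonglongrightarrow> snd p"
        using tendsto_diff[OF tendsto_const LIMSEQ_inverse_real_of_nat, of "snd p"] by simp
    qed simp
    then have "filterlim (\<lambda>n. s n (snd p)) (at_left (snd p)) sequentially"
      using upper by (auto simp: filterlim_at less_imp_neq)
    moreover have "(X (fst p) \<longlongrightarrow> X (fst p) (snd p)) (at_left (snd p))"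
      using cont[OF w t] by (simp add: continuous_within)
    ultimately show ?thesis
      by (rule filterlim_compose[rotated])
  qed
  ultimately show ?thesis
    by (rule borel_measurable_LIMSEQ_metric)
qed

lemma usual_filtration_subalgebra:
  assumes "usual_filtration M F" "0 \<le> t"
  shows "subalgebra M (F t)"
  using assms(1)[unfolded usual_filtration_def, THEN conjunct1] assms(2)
  by (simp add: subalgebra_def)

lemma space_predictable_sigma: "space (predictable_sigma M F T) = space M \<times> {0..T}"
  unfolding predictable_sigma_def by (rule space_measure_of) blast

text \<open>The generators are preimages under adapted left-continuous processes, which are jointly
  measurable. A predictable integrand can thus be treated on the product space.\<close>

lemma sets_predictable_sigma_subset:
  assumes filt: "usual_filtration M F"
  shows "sets (predictable_sigma M F T) \<subseteq> sets (M \<Otimes>\<^sub>M restrict_space borel {0..T})"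
proof -
  let ?P = "M \<Otimes>\<^sub>M restrict_space borel {0..T}"
  have sp: "space ?P = space M \<times> {0..T}"
    by (simp add: space_pair_measure space_restrict_space)
  have gen: "{p\<in>space M \<times> {0..T}. X (fst p) (snd p) \<in> B} \<in> sets ?P"
    if "adapted M F X" "\<forall>\<omega>\<in>space M. \<forall>t>0. continuous (at_left t) (X \<omega>)" "B \<in> sets borel"
    for X :: "'a \<Rightarrow> real \<Rightarrow> real" and B
  proof -
    have "(\<lambda>p. X (fst p) (snd p)) \<in> borel_measurable ?P"
    proof (rule borel_measurable_left_continuous_process)
      show "(\<lambda>\<omega>. X \<omega> s) \<in> borel_measurable M" if "0 \<le> s" for s
        using measurable_from_subalg[OF usual_filtration_subalgebra[OF filt that]] that \<open>adapted M F X\<close>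
        by (auto simp: adapted_def)
    qed (use that(2) in auto)
    from measurable_sets[OF this that(3)] show ?thesis
      by (simp add: sp vimage_def Int_def conj_commute)
  qed
  let ?G = "{{p\<in>space M \<times> {0..T}. X (fst p) (snd p) \<in> B} | (X :: 'a \<Rightarrow> real \<Rightarrow> real) B.
      adapted M F X \<and> (\<forall>\<omega>\<in>space M. \<forall>t>0. continuous (at_left t) (X \<omega>)) \<and> B \<in> sets borel}"
  have "?G \<subseteq> sets ?P" using gen by blast
  then have "sigma_sets (space ?P) ?G \<subseteq> sets ?P" by (rule sets.sigma_sets_subset)
  moreover have "?G \<subseteq> Pow (space M \<times> {0..T})" by blast
  ultimately show ?thesis
    unfolding predictable_sigma_def sp by (simp only: sets_measure_of)
qed

section \<open>Paths of bounded variation\<close>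

lemma norm_diff_le_total_variation:
  fixes x :: "real \<Rightarrow> 'b::real_normed_vector"
  assumes "s \<le> t"
  shows "ereal (norm (x t - x s)) \<le> total_variation x"
proof -
  \<comment> \<open>The partition with a single step; beyond it the points stay at \<open>t\<close>
    to keep the sequence monotone.\<close>
  let ?p = "(1 :: nat, \<lambda>i :: nat. if i = 0 then s else t)"
  have "mono (snd ?p)" using assms by (auto simp: mono_def)
  then have "ereal (\<Sum>i<fst ?p. norm (x (snd ?p (Suc i)) - x (snd ?p i))) \<le> total_variation x"
    unfolding total_variation_def by (intro SUP_upper) auto
  then show ?thesis by simp
qed

text \<open>The initial value plus the total variation bounds the path. The bound may vary with the
  path, which is enough where \<omega> is fixed.\<close>

lemma path_space_bounded:
  assumes "x \<in> path_space T"
  shows "\<exists>C. \<forall>t\<ge>0. norm (x t) \<le> C"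
proof -
  have "total_variation x < \<infinity>" using assms unfolding path_space_def by blast
  moreover have "0 \<le> total_variation x"
    using norm_diff_le_total_variation[of 0 0 x] by (simp add: zero_ereal_def)
  ultimately obtain V where V: "total_variation x = ereal V"
    by (cases "total_variation x") auto
  have "norm (x t) \<le> norm (x 0) + V" if "0 \<le> t" for t
    using norm_diff_le_total_variation[OF that, of x] norm_triangle_ineq2[of "x t" "x 0"] by (simp add: V)
  then show ?thesis by blast
qed

text \<open>Phrased through real bounds so that it serves single paths and essential bounds over
  \<omega> alike.\<close>

lemma total_variation_add_scaleR_le:
  assumes "total_variation x \<le> ereal V" "total_variation y \<le> ereal W"
  shows "total_variation (\<lambda>t. x t + a *\<^sub>R y t) \<le> ereal (V + \<bar>a\<bar> * W)"
  unfolding total_variation_def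
proof (rule SUP_least)
  fix p :: "nat \<times> (nat \<Rightarrow> real)" assume p: "p \<in> {(n, t). mono t}"
  have bound: "(\<Sum>i<fst p. norm (z (snd p (Suc i)) - z (snd p i))) \<le> U"
    if "total_variation z \<le> ereal U" for z :: "real \<Rightarrow> 'a" and U
  proof -
    have "ereal (\<Sum>i<fst p. norm (z (snd p (Suc i)) - z (snd p i))) \<le> total_variation z"
      unfolding total_variation_def using p by (intro SUP_upper) auto
    from order_trans[OF this that] show ?thesis by simp
  qed
  have "(\<Sum>i<fst p. norm (x (snd p (Suc i)) + a *\<^sub>R y (snd p (Suc i)) - (x (snd p i) + a *\<^sub>R y (snd p i))))
      \<le> (\<Sum>i<fst p. norm (x (snd p (Suc i)) - x (snd p i)) + \<bar>a\<bar> * norm (y (snd p (Suc i)) - y (snd p i)))"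
  proof (rule sum_mono)
    fix i
    have "x (snd p (Suc i)) + a *\<^sub>R y (snd p (Suc i)) - (x (snd p i) + a *\<^sub>R y (snd p i)) =
      (x (snd p (Suc i)) - x (snd p i)) + a *\<^sub>R (y (snd p (Suc i)) - y (snd p i))"
      by (simp add: algebra_simps)
    then show "norm (x (snd p (Suc i)) + a *\<^sub>R y (snd p (Suc i)) - (x (snd p i) + a *\<^sub>R y (snd p i)))
      \<le> norm (x (snd p (Suc i)) - x (snd p i)) + \<bar>a\<bar> * norm (y (snd p (Suc i)) - y (snd p i))"
      by (metis norm_scaleR norm_triangle_ineq)
  qed
  also have "\<dots> \<le> V + \<bar>a\<bar> * W"
    using bound[OF assms(1)] bound[OF assms(2)]
    by (simp add: sum.distrib sum_distrib_left[symmetric] add_mono mult_left_mono)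
  finally show "ereal (\<Sum>i<fst p. norm (x (snd p (Suc i)) + a *\<^sub>R y (snd p (Suc i)) - (x (snd p i) + a *\<^sub>R y (snd p i))))
      \<le> ereal (V + \<bar>a\<bar> * W)" by simp
qed

lemma total_variation_bounded:
  assumes "total_variation x < \<infinity>"
  obtains V where "total_variation x \<le> ereal V"
  using assms by (cases "total_variation x") auto

lemma path_spaceD:
  assumes "x \<in> path_space T"
  shows "continuous (at_left t) x" "total_variation x < \<infinity>"
    "t \<le> 0 \<Longrightarrow> x t = x 0" "T < t \<Longrightarrow> x t = x (T + 1)"
  using assms unfolding path_space_def by blast+

lemma path_space_add_scaleR:
  assumes x: "x \<in> path_space T" and y: "y \<in> path_space T"
  shows "(\<lambda>t. x t + a *\<^sub>R y t) \<in> path_space T"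
proof -
  have "total_variation x < \<infinity>" "total_variation y < \<infinity>"
    using x y by (auto dest: path_spaceD(2))
  then obtain V W where V: "total_variation x \<le> ereal V" and W: "total_variation y \<le> ereal W"
    by (metis total_variation_bounded)
  from total_variation_add_scaleR_le[OF V W]
  have "total_variation (\<lambda>t. x t + a *\<^sub>R y t) < \<infinity>"
    by (rule order_le_less_trans) simp
  moreover have "continuous (at_left t) (\<lambda>t. x t + a *\<^sub>R y t)" for t
    using x y by (intro continuous_intros) (auto dest: path_spaceD(1))
  moreover have "x t + a *\<^sub>R y t = x 0 + a *\<^sub>R y 0" if "t \<le> 0" for t
    using path_spaceD(3)[OF x that] path_spaceD(3)[OF y that] by (simp only:)
  moreover have "x t + a *\<^sub>R y t = x (T + 1) + a *\<^sub>R y (T + 1)" if "T < t" for t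
    using path_spaceD(4)[OF x that] path_spaceD(4)[OF y that] by (simp only:)
  ultimately show ?thesis
    unfolding path_space_def by blast
qed

lemma N_infty_add_scaleR:
  fixes x y :: "'w \<Rightarrow> real \<Rightarrow> 'b::euclidean_space"
  assumes x: "x \<in> N_infty M F T" and y: "y \<in> N_infty M F T"
  shows "(\<lambda>\<omega> t. x \<omega> t + a *\<^sub>R y \<omega> t) \<in> N_infty M F T"
proof -
  have "adapted M F (\<lambda>\<omega> t. x \<omega> t + a *\<^sub>R y \<omega> t)"
    using x y unfolding N_infty_def adapted_def
    by (intro allI impI borel_measurable_add borel_measurable_scaleR borel_measurable_const) auto
  moreover have "AE \<omega> in M. x \<omega> \<in> path_space T" "AE \<omega> in M. y \<omega> \<in> path_space T"
    using x y by (auto simp: N_infty_def)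
  then have "AE \<omega> in M. (\<lambda>t. x \<omega> t + a *\<^sub>R y \<omega> t) \<in> path_space T"
    by eventually_elim (rule path_space_add_scaleR)
  moreover obtain V W where V: "AE \<omega> in M. total_variation (x \<omega>) \<le> ereal V"
      and W: "AE \<omega> in M. total_variation (y \<omega>) \<le> ereal W"
    using x y by (auto simp: N_infty_def)
  have "AE \<omega> in M. total_variation (\<lambda>t. x \<omega> t + a *\<^sub>R y \<omega> t) \<le> ereal (V + \<bar>a\<bar> * W)"
    using V W by eventually_elim (rule total_variation_add_scaleR_le)
  ultimately show ?thesis
    by (auto simp: N_infty_def)
qed

text \<open>Inside \<open>N\<close> every preimage is a subset of a null set, so completeness makes
  it measurable; outside, \<open>f\<close> coincides with \<open>g\<close>.\<close>

lemma borel_measurable_complete_null: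
  fixes f g :: "'a \<Rightarrow> 'b::topological_space"
  assumes complete: "\<forall>A N. A \<in> null_sets M \<longrightarrow> N \<subseteq> A \<longrightarrow> N \<in> sets M"
    and N: "N \<in> null_sets M" and g: "g \<in> borel_measurable M"
    and eq: "\<And>\<omega>. \<omega> \<in> space M - N \<Longrightarrow> f \<omega> = g \<omega>"
  shows "f \<in> borel_measurable M"
proof (rule measurableI)
  fix B :: "'b set" assume B: "B \<in> sets borel"
  have split: "f -` B \<inter> space M = (g -` B \<inter> space M - N) \<union> (f -` B \<inter> space M \<inter> N)"
    using eq by auto
  have "g -` B \<inter> space M \<in> sets M" using g B by (rule measurable_sets)
  moreover have "f -` B \<inter> space M \<inter> N \<in> sets M"
    by (rule complete[rule_format, OF N]) auto
  ultimately show "f -` B \<inter> space M \<in> sets M"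
    using N by (subst split) (intro sets.Un sets.Diff null_setsD2[OF N])
qed simp

section \<open>Integral functionals\<close>

lemma borel_measurable_nn_integral_random_measure:
  assumes mu: "random_measure_ok M F T \<mu>" and T: "0 < T"
    and f: "(\<lambda>(\<omega>, t). f \<omega> t) \<in> borel_measurable (M \<Otimes>\<^sub>M restrict_space borel {0..T})"
  shows "(\<lambda>\<omega>. \<integral>\<^sup>+ t. f \<omega> t \<partial>\<mu> \<omega>) \<in> borel_measurable M"
proof (rule borel_measurable_nn_integral_kernel[OF _ _ _ _ f])
  show "(\<lambda>\<omega>. emeasure (\<mu> \<omega>) A) \<in> borel_measurable M"
    if A: "A \<in> sets (restrict_space borel {0..T})" for A
  proof -
    obtain B where "B \<in> sets borel" "A = B \<inter> {0..T}"
      using A by (auto simp: sets_restrict_space Int_commute)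
    then show ?thesis using mu by (auto simp: random_measure_ok_def)
  qed
qed (use mu T in \<open>auto simp: random_measure_ok_def space_restrict_space\<close>)

text \<open>The inner integral is a measurable nonnegative function of \<omega> with finite
  expectation, hence finite almost surely.\<close>

lemma AE_in_L1_eta_finite:
  assumes mu: "random_measure_ok M F T \<mu>" and T: "0 < T" and v: "in_L1_eta M \<mu> v"
  shows "AE \<omega> in M. v \<omega> \<in> borel_measurable (\<mu> \<omega>) \<and> (\<integral>\<^sup>+ t. ennreal (norm (v \<omega> t)) \<partial>\<mu> \<omega>) < \<infinity>"
proof -
  have vm: "(\<lambda>(\<omega>, t). v \<omega> t) \<in> borel_measurable (M \<Otimes>\<^sub>M borel)"
    using v by (simp add: in_L1_eta_def case_prod_beta')
  have snd: "snd \<in> M \<Otimes>\<^sub>M restrict_space borel {0..T} \<rightarrow>\<^sub>M borel"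
    by (rule measurable_compose[OF measurable_snd, of "\<lambda>t. t", simplified])
      (simp add: measurable_restrict_space1)
  have incl: "(\<lambda>p. p) \<in> M \<Otimes>\<^sub>M restrict_space borel {0..T} \<rightarrow>\<^sub>M M \<Otimes>\<^sub>M borel"
    using measurable_Pair[OF measurable_fst snd] by simp
  have vm': "(\<lambda>(\<omega>, t). ennreal (norm (v \<omega> t))) \<in> borel_measurable (M \<Otimes>\<^sub>M restrict_space borel {0..T})"
    using measurable_compose[OF incl vm] by (simp add: case_prod_beta')
  have "(\<lambda>\<omega>. \<integral>\<^sup>+ t. ennreal (norm (v \<omega> t)) \<partial>\<mu> \<omega>) \<in> borel_measurable M"
    by (rule borel_measurable_nn_integral_random_measure[OF mu T vm'])
  then have "AE \<omega> in M. (\<integral>\<^sup>+ t. ennreal (norm (v \<omega> t)) \<partial>\<mu> \<omega>) \<noteq> \<infinity>"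
    using v by (intro nn_integral_PInf_AE) (auto simp: in_L1_eta_def)
  then show ?thesis
    using AE_space
  proof eventually_elim
    case (elim \<omega>)
    have "sets (\<mu> \<omega>) = sets (restrict_space borel {0..T})"
      using mu elim by (simp add: random_measure_ok_def)
    moreover have "v \<omega> \<in> borel_measurable (restrict_space borel {0..T})"
      using measurable_Pair2[OF vm elim(2)] by (simp add: measurable_restrict_space1)
    ultimately show ?case
      using elim by (simp add: less_top cong: measurable_cong_sets)
  qed
qed

text \<open>A normal integrand composed with a jointly measurable process is jointly measurable, and
  integration against the random measure keeps measurability in \<omega>. A single path may be
  inserted as a process constant in \<omega>.\<close>

lemma I_int_left_continuous:
  fixes X :: "'w \<Rightarrow> real \<Rightarrow> 'b::euclidean_space"
  assumes filt: "usual_filtration M F" and mu: "random_measure_ok M F T \<mu>" and T: "0 < T"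
    and h: "normal_integrand (predictable_sigma M F T) (\<lambda>p. h (fst p) (snd p))"
    and meas: "\<And>s. 0 \<le> s \<Longrightarrow> (\<lambda>\<omega>. X \<omega> s) \<in> borel_measurable M"
    and cont: "\<And>\<omega> t. \<omega> \<in> space M \<Longrightarrow> 0 < t \<Longrightarrow> continuous (at_left t) (X \<omega>)"
  shows borel_measurable_integrand: "\<omega> \<in> space M \<Longrightarrow> (\<lambda>t. h \<omega> t (X \<omega> t)) \<in> borel_measurable (\<mu> \<omega>)"
    and borel_measurable_I_int: "I_int \<mu> h X \<in> borel_measurable M"
proof -
  let ?P = "M \<Otimes>\<^sub>M restrict_space borel {0..T}"
  have "normal_integrand ?P (\<lambda>p. h (fst p) (snd p))"
    by (rule normal_integrand_mono[OF h _ sets_predictable_sigma_subset[OF filt]]) (simp add: space_predictable_sigma space_pair_measure space_restrict_space)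
  then have "(\<lambda>p. h (fst p) (snd p) (X (fst p) (snd p))) \<in> borel_measurable ?P"
    by (rule borel_measurable_normal_integrand)
      (rule borel_measurable_left_continuous_process[OF meas cont])
  then have hX[measurable]: "(\<lambda>(\<omega>, t). h \<omega> t (X \<omega> t)) \<in> borel_measurable ?P"
    by (simp add: case_prod_beta')
  show "(\<lambda>t. h \<omega> t (X \<omega> t)) \<in> borel_measurable (\<mu> \<omega>)" if w: "\<omega> \<in> space M"
  proof -
    have "sets (\<mu> \<omega>) = sets (restrict_space borel {0..T})"
      using mu w by (simp add: random_measure_ok_def)
    then show ?thesis
      using measurable_Pair2[OF hX w] by (simp cong: measurable_cong_sets)
  qed
  have [measurable]: "(\<lambda>\<omega>. \<integral>\<^sup>+ t. e2ennreal (max 0 (h \<omega> t (X \<omega> t))) \<partial>\<mu> \<omega>) \<in> borel_measurable M"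
    by (rule borel_measurable_nn_integral_random_measure[OF mu T]) measurable
  have [measurable]: "(\<lambda>\<omega>. \<integral>\<^sup>+ t. e2ennreal (max 0 (- h \<omega> t (X \<omega> t))) \<partial>\<mu> \<omega>) \<in> borel_measurable M"
    by (rule borel_measurable_nn_integral_random_measure[OF mu T]) measurable
  show "I_int \<mu> h X \<in> borel_measurable M"
    unfolding I_int_def[abs_def] ext_integral_def Let_def by measurable
qed

text \<open>Paths are left-continuous only almost surely. Replacing them by the zero path on the
  exceptional null set makes the preceding results applicable, and completeness returns to
  \<open>x\<close>.\<close>

lemma borel_measurable_f_int:
  fixes x :: "'w \<Rightarrow> real \<Rightarrow> 'b::euclidean_space"
  assumes filt: "usual_filtration M F" and mu: "random_measure_ok M F T \<mu>" and T: "0 < T"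
    and h: "normal_integrand (predictable_sigma M F T) (\<lambda>p. h (fst p) (snd p))"
    and k0: "normal_integrand M k0" and kT: "normal_integrand M kT"
    and x: "x \<in> N_infty M F T"
  shows "f_int \<mu> T h k0 kT x \<in> borel_measurable M"
proof -
  have "AE \<omega> in M. x \<omega> \<in> path_space T" using x by (simp add: N_infty_def)
  then obtain N where N: "N \<in> null_sets M" "\<And>\<omega>. \<omega> \<in> space M - N \<Longrightarrow> x \<omega> \<in> path_space T"
    by (auto simp: eventually_ae_filter)
  define X where "X \<omega> t = (if \<omega> \<in> N then 0 else x \<omega> t)" for \<omega> t
  have [measurable]: "N \<in> sets M" using N by auto
  have X_meas: "(\<lambda>\<omega>. X \<omega> s) \<in> borel_measurable M" if "0 \<le> s" for s
  proof -
    have [measurable]: "(\<lambda>\<omega>. x \<omega> s) \<in> borel_measurable M"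
      using measurable_from_subalg[OF usual_filtration_subalgebra[OF filt that]] that x
      by (auto simp: N_infty_def adapted_def)
    show ?thesis unfolding X_def by measurable
  qed
  have X_cont: "continuous (at_left t) (X \<omega>)" if "\<omega> \<in> space M" for \<omega> t
    using N(2)[of \<omega>] that unfolding X_def[abs_def] by (cases "\<omega> \<in> N") (auto dest: path_spaceD(1))
  have [measurable]: "I_int \<mu> h X \<in> borel_measurable M"
    by (rule borel_measurable_I_int[OF filt mu T h X_meas X_cont])
  have [measurable]: "(\<lambda>\<omega>. k0 \<omega> (X \<omega> 0)) \<in> borel_measurable M" "(\<lambda>\<omega>. kT \<omega> (X \<omega> (T + 1))) \<in> borel_measurable M"
    using T by (auto intro!: borel_measurable_normal_integrand k0 kT X_meas)
  have "f_int \<mu> T h k0 kT X \<in> borel_measurable M"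
    unfolding f_int_def[abs_def] endval_def by measurable
  moreover have "\<forall>A N. A \<in> null_sets M \<longrightarrow> N \<subseteq> A \<longrightarrow> N \<in> sets M"
    using filt by (simp add: usual_filtration_def)
  ultimately show ?thesis
    using N(1) by (elim borel_measurable_complete_null[rotated 2])
      (auto simp: f_int_def I_int_def endval_def X_def)
qed

section \<open>Difference quotients of the integral term along a fixed ray\<close>

text \<open>This is the integration over time with \<omega> fixed. Bounded paths turn the affine
  minorant of \<open>g\<close> into an integrable one, which excludes -\<infinity>; convexity then
  supplies monotone quotients for monotone convergence.\<close>

lemma ext_integral_integrand_diff_quot:
  fixes g :: "'s \<Rightarrow> 'b::euclidean_space \<Rightarrow> ereal"
  assumes meas: "\<And>a. 0 \<le> a \<Longrightarrow> (\<lambda>t. g t (y t + a *\<^sub>R x t)) \<in> borel_measurable N"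
    and cvx: "\<And>t. t \<in> space N \<Longrightarrow> convex (epi (g t))" and cl: "\<And>t. t \<in> space N \<Longrightarrow> closed (epi (g t))"
    and v: "v \<in> borel_measurable N" "(\<integral>\<^sup>+ t. ennreal (norm (v t)) \<partial>N) < \<infinity>"
    and \<alpha>: "\<alpha> \<in> borel_measurable N" "(\<integral>\<^sup>+ t. ennreal (norm (\<alpha> t)) \<partial>N) < \<infinity>"
    and lb: "AE t in N. \<forall>z. ereal (z \<bullet> v t - \<alpha> t) \<le> g t z"
    and bdd: "\<And>t. t \<in> space N \<Longrightarrow> norm (y t) \<le> C" "\<And>t. t \<in> space N \<Longrightarrow> norm (x t) \<le> D"
    and fin: "ext_integral N (\<lambda>t. g t (y t)) \<noteq> \<infinity>" "ext_integral N (\<lambda>t. g t (y t)) \<noteq> -\<infinity>"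
  defines "J \<equiv> (\<lambda>a. ext_integral N (\<lambda>t. g t (y t + a *\<^sub>R x t)))"
  shows ext_integral_integrand_neq_MInf: "0 < a \<Longrightarrow> J a \<noteq> -\<infinity>"
    and ext_integral_integrand_diff_quot_mono: "0 < a \<Longrightarrow> a \<le> b \<Longrightarrow> diff_quot J a \<le> diff_quot J b"
    and ext_integral_integrand_SUP_diff_quot: "(SUP a\<in>{0<..}. diff_quot J a) = ext_integral N (\<lambda>t. recession (g t) (x t))"
proof -
  have [measurable]: "v \<in> borel_measurable N" "\<alpha> \<in> borel_measurable N" by fact+
  show low: "J a \<noteq> -\<infinity>" if a: "0 < a" for a
  proof -
    \<comment> \<open>A bound for the norm of \<open>y + a *\<^sub>R x\<close> on \<open>N\<close>;
      the maximum with 0 supplies the nonnegativity used to split the \<open>ennreal\<close>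
      product.\<close>
    define K where "K = max 0 (C + a * D)"
    have "AE t in N. e2ennreal (max 0 (- g t (y t + a *\<^sub>R x t))) \<le> ennreal K * ennreal (norm (v t)) + ennreal (norm (\<alpha> t))"
      using lb AE_space
    proof eventually_elim
      case (elim t)
      let ?z = "y t + a *\<^sub>R x t"
      have "norm ?z \<le> norm (y t) + a * norm (x t)"
        using norm_triangle_ineq[of "y t" "a *\<^sub>R x t"] a by simp
      also have "\<dots> \<le> K"
        unfolding K_def using bdd[OF elim(2)] a by (intro max.coboundedI2 add_mono mult_left_mono) auto
      finally have "norm ?z * norm (v t) \<le> K * norm (v t)"
        by (intro mult_right_mono) auto
      then have "- (?z \<bullet> v t - \<alpha> t) \<le> K * norm (v t) + norm (\<alpha> t)"
        using Cauchy_Schwarz_ineq2[of ?z "v t"] by simp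
      moreover have "- g t ?z \<le> ereal (- (?z \<bullet> v t - \<alpha> t))"
        using elim(1)[rule_format, of ?z] by (metis ereal_minus_le_minus uminus_ereal.simps(1))
      ultimately have "- g t ?z \<le> ereal (K * norm (v t) + norm (\<alpha> t))"
        by (meson ereal_less_eq(3) order_trans)
      then have "e2ennreal (max 0 (- g t ?z)) \<le> ennreal (K * norm (v t) + norm (\<alpha> t))"
        unfolding e2ennreal_max_ereal[symmetric] by (intro e2ennreal_mono max.mono) auto
      then show ?case
        by (simp add: ennreal_plus ennreal_mult K_def)
    qed
    then have "(\<integral>\<^sup>+ t. e2ennreal (max 0 (- g t (y t + a *\<^sub>R x t))) \<partial>N) \<le>
        (\<integral>\<^sup>+ t. ennreal K * ennreal (norm (v t)) + ennreal (norm (\<alpha> t)) \<partial>N)"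
      by (rule nn_integral_mono_AE)
    also have "\<dots> = ennreal K * (\<integral>\<^sup>+ t. ennreal (norm (v t)) \<partial>N) + (\<integral>\<^sup>+ t. ennreal (norm (\<alpha> t)) \<partial>N)"
      by (subst nn_integral_add) (auto simp: nn_integral_cmult)
    also have "\<dots> < \<infinity>"
      using v(2) \<alpha>(2) by (simp add: ennreal_mult_less_top)
    finally have n: "(\<integral>\<^sup>+ t. e2ennreal (max 0 (- g t (y t + a *\<^sub>R x t))) \<partial>N) \<noteq> \<infinity>" by simp
    have "enn2ereal p - enn2ereal n \<noteq> -\<infinity>" if "n \<noteq> \<infinity>" for p n
      using that by (cases p; cases n) auto
    then show ?thesis
      using n by (auto simp: J_def ext_integral_def Let_def)
  qed
  \<comment> \<open>A finite integral makes the value at \<open>y t\<close> real for almost every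
    \<open>t\<close>, so \<open>y t\<close> is a valid base point there.\<close>
  have base: "AE t in N. \<exists>r. g t (y t) = ereal r"
  proof -
    have "(\<lambda>t. g t (y t)) \<in> borel_measurable N" using meas[of 0] by simp
    then obtain q where "AE t in N. g t (y t) = ereal (q t)"
      using fin by (rule ext_integral_finiteE)
    then show ?thesis by eventually_elim auto
  qed
  have mono: "AE t in N. \<forall>a b. 0 < a \<longrightarrow> a \<le> b \<longrightarrow>
      diff_quot (\<lambda>a. g t (y t + a *\<^sub>R x t)) a \<le> diff_quot (\<lambda>a. g t (y t + a *\<^sub>R x t)) b"
    using base AE_space
  proof eventually_elim
    case (elim t)
    then obtain r where "g t (y t) = ereal r" by blast
    then show ?case using cvx[OF elim(2)] by (intro allI impI diff_quot_mono)
  qed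
  have J0: "J 0 = ext_integral N (\<lambda>t. g t (y t))" by (simp add: J_def)
  show "diff_quot J a \<le> diff_quot J b" if "0 < a" "a \<le> b" for a b
    unfolding J_def
    by (rule ext_integral_diff_quot_mono[where \<Phi> = "\<lambda>a t. g t (y t + a *\<^sub>R x t)", OF meas _ _ _ mono that])
      (use low fin J0 in \<open>auto simp: J_def\<close>)
  have "(SUP a\<in>{0<..}. diff_quot J a) = ext_integral N (\<lambda>t. SUP a\<in>{0<..}. diff_quot (\<lambda>a. g t (y t + a *\<^sub>R x t)) a)"
    unfolding J_def
    by (rule ext_integral_SUP_diff_quot[where \<Phi> = "\<lambda>a t. g t (y t + a *\<^sub>R x t)", OF meas _ _ _ mono])
      (use low fin J0 in \<open>auto simp: J_def\<close>)
  \<comment> \<open>The supremum is the recession function based at \<open>y t\<close>; base point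
    independence applies because the minorant excludes the value -\<infinity>.\<close>
  also have "\<dots> = ext_integral N (\<lambda>t. recession (g t) (x t))"
  proof (rule ext_integral_cong_AE, use base lb AE_space in eventually_elim)
    case (elim t)
    then obtain r where r: "g t (y t) = ereal r" by blast
    have "g t z \<noteq> -\<infinity>" for z
      using elim(2)[rule_format, of z] by auto
    then have "recession (g t) (x t) = recession_at (g t) (y t) (x t)"
      using recession_eq_recession_at[OF cvx[OF elim(3)] cl[OF elim(3)] _ r] by blast
    then show ?case by (simp add: recession_at_def)
  qed
  finally show "(SUP a\<in>{0<..}. diff_quot J a) = ext_integral N (\<lambda>t. recession (g t) (x t))" .
qed

section \<open>The recession formula for the expected functional\<close>

theorem theorem13:
  fixes M :: "'w measure" and F :: "real \<Rightarrow> 'w measure" and T :: real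
    and \<mu> :: "'w \<Rightarrow> real measure"
    and h :: "'w \<Rightarrow> real \<Rightarrow> real^'n \<Rightarrow> ereal"
    and k0 kT :: "'w \<Rightarrow> real^'n \<Rightarrow> ereal"
    and v :: "'w \<Rightarrow> real \<Rightarrow> real^'n" and \<alpha> :: "'w \<Rightarrow> real \<Rightarrow> real"
  assumes T: "T > 0"
    and P: "prob_space M"
    and filt: "usual_filtration M F"
    and mu: "random_measure_ok M F T \<mu>"
    and h_ni: "convex_normal_integrand (predictable_sigma M F T) (\<lambda>p. h (fst p) (snd p))"
    and v_L1: "in_L1_eta M \<mu> v"
    and \<alpha>_L1: "in_L1_eta M \<mu> \<alpha>" and \<alpha>_nn: "\<forall>\<omega> t. 0 \<le> \<alpha> \<omega> t"
    and h_lb: "AE \<omega> in M. AE t in \<mu> \<omega>. \<forall>y. ereal (y \<bullet> v \<omega> t - \<alpha> \<omega> t) \<le> h \<omega> t y"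
    and k0_ni: "convex_normal_integrand (F 0) k0"
    and kT_ni: "convex_normal_integrand (F T) kT"
    and k0_prop: "proper_on (L_infty M) (\<lambda>u. ext_integral M (\<lambda>\<omega>. k0 \<omega> (u \<omega>)))"
    and kT_prop: "proper_on (L_infty M) (\<lambda>u. ext_integral M (\<lambda>\<omega>. kT \<omega> (u \<omega>)))"
    and k0s_prop: "proper_on (L_one M) (\<lambda>y. ext_integral M (\<lambda>\<omega>. conjugate (k0 \<omega>) (y \<omega>)))"
    and kTs_prop: "proper_on (L_one M) (\<lambda>y. ext_integral M (\<lambda>\<omega>. conjugate (kT \<omega>) (y \<omega>)))"
    and Ef_proper: "proper_on (N_infty M F T) (Ef M \<mu> T h k0 kT)"
  shows "\<forall>xb\<in>N_infty M F T. \<forall>x\<in>N_infty M F T.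
           Ef M \<mu> T h k0 kT xb \<noteq> \<infinity> \<longrightarrow>
           (SUP a\<in>{0<..}.
              (Ef M \<mu> T h k0 kT (\<lambda>\<omega> t. xb \<omega> t + a *\<^sub>R x \<omega> t) - Ef M \<mu> T h k0 kT xb) / ereal a)
           = Ef M \<mu> T (\<lambda>\<omega> t. recession (h \<omega> t)) (\<lambda>\<omega>. recession (k0 \<omega>)) (\<lambda>\<omega>. recession (kT \<omega>)) x"
proof (intro ballI impI)
  fix xb x :: "'w \<Rightarrow> real \<Rightarrow> real^'n"
  assume xb: "xb \<in> N_infty M F T" and x: "x \<in> N_infty M F T"
    and fin: "Ef M \<mu> T h k0 kT xb \<noteq> \<infinity>"
  have h: "normal_integrand (predictable_sigma M F T) (\<lambda>p. h (fst p) (snd p))"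
    using h_ni by (simp add: convex_normal_integrand_def)
  have F0: "space (F 0) = space M" "sets (F 0) \<subseteq> sets M" and FT: "space (F T) = space M" "sets (F T) \<subseteq> sets M"
    using usual_filtration_subalgebra[OF filt] T by (auto simp: subalgebra_def)
  have k0: "normal_integrand M k0"
    using k0_ni F0 unfolding convex_normal_integrand_def by (blast intro: normal_integrand_mono sym)
  have kT: "normal_integrand M kT"
    using kT_ni FT unfolding convex_normal_integrand_def by (blast intro: normal_integrand_mono sym)
  \<comment> \<open>Properness of each conjugate functional provides an integrable \<open>y\<close>
    at which it is not \<infinity>.\<close>
  have k0_neq: "AE \<omega> in M. \<forall>z. k0 \<omega> z \<noteq> -\<infinity>" and kT_neq: "AE \<omega> in M. \<forall>z. kT \<omega> z \<noteq> -\<infinity>"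
    using k0s_prop kTs_prop AE_normal_integrand_neq_MInf[OF k0] AE_normal_integrand_neq_MInf[OF kT]
    unfolding proper_on_def by blast+
  define X where "X a = (\<lambda>\<omega> t. xb \<omega> t + a *\<^sub>R x \<omega> t)" for a :: real
  have X: "X a \<in> N_infty M F T" for a
    unfolding X_def by (rule N_infty_add_scaleR[OF xb x])
  have X0: "X 0 = xb" by (simp add: X_def)
  define \<Phi> where "\<Phi> a = f_int \<mu> T h k0 kT (X a)" for a
  have Ef_eq: "Ef M \<mu> T h k0 kT (X a) = ext_integral M (\<Phi> a)" for a
    by (simp add: Ef_def \<Phi>_def)
  have meas: "\<Phi> a \<in> borel_measurable M" for a
    unfolding \<Phi>_def by (rule borel_measurable_f_int[OF filt mu T h k0 kT X])
  \<comment> \<open>The whole ray stays in \<open>N_infty\<close>, where properness of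
    \<open>Ef\<close> rules out -\<infinity>.\<close>
  have low: "ext_integral M (\<Phi> a) \<noteq> -\<infinity>" for a
    using Ef_proper X[of a] by (simp add: proper_on_def Ef_eq[symmetric])
  have fin0: "ext_integral M (\<Phi> 0) \<noteq> \<infinity>"
    using fin by (simp add: Ef_eq[symmetric] X0)
  obtain \<phi> where \<phi>: "AE \<omega> in M. \<Phi> 0 \<omega> = ereal (\<phi> \<omega>)"
    using meas fin0 low by (rule ext_integral_finiteE)
  have paths: "AE \<omega> in M. xb \<omega> \<in> path_space T" "AE \<omega> in M. x \<omega> \<in> path_space T"
    using xb x by (simp_all add: N_infty_def)
  let ?R = "f_int \<mu> T (\<lambda>\<omega> t. recession (h \<omega> t)) (\<lambda>\<omega>. recession (k0 \<omega>)) (\<lambda>\<omega>. recession (kT \<omega>)) x"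
  \<comment> \<open>For fixed \<omega>, \<open>f_int\<close> along the ray is the sum of an integral
    term and two endpoint terms. Each has monotone quotients whose supremum is the corresponding
    recession term.\<close>
  have pointwise: "AE \<omega> in M. (\<forall>a b. 0 < a \<longrightarrow> a \<le> b \<longrightarrow> diff_quot (\<lambda>a. \<Phi> a \<omega>) a \<le> diff_quot (\<lambda>a. \<Phi> a \<omega>) b) \<and>
      (SUP a\<in>{0<..}. diff_quot (\<lambda>a. \<Phi> a \<omega>) a) = ?R \<omega>"
    using \<phi> paths h_lb AE_in_L1_eta_finite[OF mu T v_L1] AE_in_L1_eta_finite[OF mu T \<alpha>_L1]
      k0_neq kT_neq AE_space
  proof eventually_elim
    case (elim \<omega>)
    note w = elim(9)
    have space: "space (\<mu> \<omega>) = {0..T}"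
    proof -
      have "sets (\<mu> \<omega>) = sets (restrict_space borel {0..T})"
        using mu w by (simp add: random_measure_ok_def)
      from sets_eq_imp_space_eq[OF this] show ?thesis by (simp add: space_restrict_space)
    qed
    define p where "p a = ext_integral (\<mu> \<omega>) (\<lambda>t. h \<omega> t (xb \<omega> t + a *\<^sub>R x \<omega> t))" for a
    define q where "q a = k0 \<omega> (xb \<omega> 0 + a *\<^sub>R x \<omega> 0)" for a
    define r where "r a = kT \<omega> (xb \<omega> (T + 1) + a *\<^sub>R x \<omega> (T + 1))" for a
    have \<Phi>_eq: "\<Phi> a \<omega> = p a + q a + r a" for a
      by (simp add: \<Phi>_def f_int_def I_int_def endval_def X_def p_def q_def r_def)
    have "p 0 + q 0 + r 0 = ereal (\<phi> \<omega>)"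
      using elim(1) by (simp add: \<Phi>_eq)
    \<comment> \<open>A sum in \<open>ereal\<close> with an infinite summand is infinite, since even
      \<infinity> + (-\<infinity>) evaluates to \<infinity>; a real sum therefore forces three real
      summands.\<close>
    then obtain p0 q0 r0 where p0: "p 0 = ereal p0" and q0: "q 0 = ereal q0" and r0: "r 0 = ereal r0"
      by (cases "p 0"; cases "q 0"; cases "r 0") auto
    obtain C D where C: "\<And>t. 0 \<le> t \<Longrightarrow> norm (xb \<omega> t) \<le> C" and D: "\<And>t. 0 \<le> t \<Longrightarrow> norm (x \<omega> t) \<le> D"
      using path_space_bounded[OF elim(2)] path_space_bounded[OF elim(3)] by blast
    \<comment> \<open>The fixed path is viewed as a process constant in its random argument, hence
      trivially measurable at each time and left-continuous everywhere.\<close>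
    have h_meas: "(\<lambda>t. h \<omega> t (xb \<omega> t + a *\<^sub>R x \<omega> t)) \<in> borel_measurable (\<mu> \<omega>)" for a
      using borel_measurable_integrand[OF filt mu T h, of "\<lambda>_ t. xb \<omega> t + a *\<^sub>R x \<omega> t", OF _ _ w]
        path_spaceD(1)[OF path_space_add_scaleR[OF elim(2,3)]] by simp
    have h_epi: "convex (epi (h \<omega> t))" "closed (epi (h \<omega> t))" if "t \<in> space (\<mu> \<omega>)" for t
      using h_ni w that
      by (auto simp: convex_normal_integrand_def normal_integrand_def space_predictable_sigma space)
    have p0_fin: "ext_integral (\<mu> \<omega>) (\<lambda>t. h \<omega> t (xb \<omega> t)) \<noteq> \<infinity>"
        "ext_integral (\<mu> \<omega>) (\<lambda>t. h \<omega> t (xb \<omega> t)) \<noteq> -\<infinity>"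
      using p0 by (simp_all add: p_def)
    have bdd: "norm (xb \<omega> t) \<le> C" "norm (x \<omega> t) \<le> D" if "t \<in> space (\<mu> \<omega>)" for t
      using that C D by (simp_all add: space)
    note integrand = h_meas h_epi conjunct1[OF elim(5)] conjunct2[OF elim(5)]
      conjunct1[OF elim(6)] conjunct2[OF elim(6)] elim(4) bdd p0_fin
    have p: "p a \<noteq> -\<infinity>" if "0 < a" for a
      unfolding p_def by (rule ext_integral_integrand_neq_MInf[OF integrand that])
    have p_mono: "diff_quot p a \<le> diff_quot p b" if "0 < a" "a \<le> b" for a b
      unfolding p_def by (rule ext_integral_integrand_diff_quot_mono[OF integrand that])
    have p_SUP: "(SUP a\<in>{0<..}. diff_quot p a) = I_int \<mu> (\<lambda>\<omega> t. recession (h \<omega> t)) x \<omega>"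
      unfolding p_def I_int_def by (rule ext_integral_integrand_SUP_diff_quot[OF integrand])
    have k_epi: "convex (epi (k0 \<omega>))" "closed (epi (k0 \<omega>))" "convex (epi (kT \<omega>))" "closed (epi (kT \<omega>))"
      using k0_ni kT_ni w F0(1) FT(1) by (auto simp: convex_normal_integrand_def normal_integrand_def)
    have q0': "k0 \<omega> (xb \<omega> 0) = ereal q0" and r0': "kT \<omega> (xb \<omega> (T + 1)) = ereal r0"
      using q0 r0 by (simp_all add: q_def r_def)
    have q: "q a \<noteq> -\<infinity>" and r: "r a \<noteq> -\<infinity>" for a
      using elim(7,8) by (simp_all add: q_def r_def)
    have q_mono: "diff_quot q a \<le> diff_quot q b" and r_mono: "diff_quot r a \<le> diff_quot r b" if "0 < a" "a \<le> b" for a b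
      unfolding q_def r_def
      by (rule diff_quot_mono[OF k_epi(1) q0' that], rule diff_quot_mono[OF k_epi(3) r0' that])
    have q_SUP: "(SUP a\<in>{0<..}. diff_quot q a) = recession (k0 \<omega>) (x \<omega> 0)"
      using recession_eq_recession_at[OF k_epi(1,2) elim(7)[rule_format] q0']
      by (simp add: recession_at_def q_def)
    have r_SUP: "(SUP a\<in>{0<..}. diff_quot r a) = recession (kT \<omega>) (endval T (x \<omega>))"
      using recession_eq_recession_at[OF k_epi(3,4) elim(8)[rule_format] r0']
      by (simp add: recession_at_def r_def endval_def)
    note sum = p0 p p_mono q0 q q_mono r0 r r_mono
    show ?case
      unfolding \<Phi>_eq
    proof (intro conjI allI impI)
      show "diff_quot (\<lambda>a. p a + q a + r a) a \<le> diff_quot (\<lambda>a. p a + q a + r a) b" if "0 < a" "a \<le> b" for a b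
        by (rule diff_quot_add3_mono[where p = p and q = q and r = r, OF sum that])
      show "(SUP a\<in>{0<..}. diff_quot (\<lambda>a. p a + q a + r a) a) = ?R \<omega>"
        unfolding f_int_def p_SUP[symmetric] q_SUP[symmetric] r_SUP[symmetric]
        by (rule SUP_diff_quot_add3[where p = p and q = q and r = r, OF sum])
    qed
  qed
  \<comment> \<open>The integration over the probability space: the monotone quotients just obtained
    enter here, and properness of \<open>Ef\<close> excludes -\<infinity>.\<close>
  have "(SUP a\<in>{0<..}. diff_quot (\<lambda>a. ext_integral M (\<Phi> a)) a) =
      ext_integral M (\<lambda>\<omega>. SUP a\<in>{0<..}. diff_quot (\<lambda>a. \<Phi> a \<omega>) a)"
  proof (rule ext_integral_SUP_diff_quot[where \<Phi> = \<Phi>, OF meas low fin0 low])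
    show "AE \<omega> in M. \<forall>a b. 0 < a \<longrightarrow> a \<le> b \<longrightarrow> diff_quot (\<lambda>a. \<Phi> a \<omega>) a \<le> diff_quot (\<lambda>a. \<Phi> a \<omega>) b"
      using pointwise by (rule eventually_mono) blast
  qed
  also have "\<dots> = ext_integral M ?R"
  proof (rule ext_integral_cong_AE)
    show "AE \<omega> in M. (SUP a\<in>{0<..}. diff_quot (\<lambda>a. \<Phi> a \<omega>) a) = ?R \<omega>"
      using pointwise by (rule eventually_mono) blast
  qed
  finally show "(SUP a\<in>{0<..}.
      (Ef M \<mu> T h k0 kT (\<lambda>\<omega> t. xb \<omega> t + a *\<^sub>R x \<omega> t) - Ef M \<mu> T h k0 kT xb) / ereal a)
    = Ef M \<mu> T (\<lambda>\<omega> t. recession (h \<omega> t)) (\<lambda>\<omega>. recession (k0 \<omega>)) (\<lambda>\<omega>. recession (kT \<omega>)) x"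
    unfolding Ef_eq[symmetric] X0 unfolding X_def by (simp only: Ef_def)
qed

end
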